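(* Let $\Omega$, $\Phi$, $\mathcal{A}$, $\mathcal{S}$ be as in the context. For any nonnegative Borel measure $\mu$ on $\Omega$ and any $s > 0$, there is a constant $c > 0$ such that $\mathcal{A}(E) \geq c\,[\mu(E)]^{k+s}$ for all Borel sets $E \subset \Omega$ if and only if there is a constant $c' > 0$ such that $\mathcal{S}(E) \geq c'\,[\mu(E)]^s$ for all Borel sets $E \subset \Omega$. Moreover, if $\|\mathcal{A}\|_{\mu,s}$ denotes the supremum of all $c \geq 0$ such that $\mathcal{A}(E) \geq c\,[\mu(E)]^{k+s}$ for all Borel $E \subset \Omega$, and $\|\mathcal{S}\|_{\mu,s}$ denotes the supremum of all $c' \geq 0$ such that $\mathcal{S}(E) \geq c'\,[\mu(E)]^{s}$ for all Borel $E \subset \Omega$, then $$\|\mathcal{S}\|_{\mu,s} \geq \|\mathcal{A}\|_{\mu,s} \geq C^{-1} \|\mathcal{S}\|_{\mu,s},$$ where the constant $C\in(0,\infty)$ depends only on $(n,k,s,\deg\Phi)$.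
   Context: $\Omega \subset \mathbb{R}^n$ is a domain (in particular an open set), and $k, m \ge 1$ are integers. $\Phi : \Omega^k \to \mathbb{R}^m$ is a polynomial in $(x_1,\ldots,x_k)$ which vanishes to order $q \geq 1$ on the diagonal $\Delta := \{(x_1,\ldots,x_k) \in \Omega^k : x_1 = \cdots = x_k\}$, meaning that all partial derivatives of $\Phi$ of order less than $q$ vanish identically on $\Delta$ and some partial derivative of order $q$ is nonzero at some point of $\Delta$. $|\cdot|$ denotes some fixed but arbitrary norm on $\mathbb{R}^m$. For Borel $E \subset \Omega$ and a nonnegative Borel measure $\mu$ on $\Omega$, $$\mathcal{A}(E) := \int_{E^k} |\Phi(x_1,\ldots,x_k)| \, d\mu(x_1) \cdots d\mu(x_k), \qquad \mathcal{S}(E) := \sup_{(x_1,\ldots,x_k) \in E^k} |\Phi(x_1,\ldots,x_k)|.$$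
   Formalization: The nonnegative Borel measure μ is assumed σ-finite: otherwise the product integral defining 𝒜 is not canonical and the equivalence can fail, e.g. for μ = ∞·Lebesgue, where 𝒜(E) = ∞ whenever μ(E) > 0 but 𝒮(E) < ∞ = μ(E) for bounded open E. *)

theory Defs
  imports "HOL-Analysis.Analysis"
begin

text \<open>
  A point of \<open>E\<^sup>k\<close> is an extensional function in \<open>{..<k} \<rightarrow>\<^sub>E E\<close>, so that product measures
  \<open>PiM {..<k} (\<lambda>_. \<mu>)\<close> live on these points. The target \<open>\<real>\<^sup>m\<close> is modelled by real sequences
  that vanish from index \<open>m\<close> on: in this way \<open>m\<close> is a natural number that can be quantified
  inside a formula, as needed for constants that must not depend on \<open>m\<close>.
\<close>

type_synonym 'n tuple = "nat \<Rightarrow> real ^ 'n"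

definition real_space :: "nat \<Rightarrow> (nat \<Rightarrow> real) set" where
  "real_space m = {v. \<forall>j\<ge>m. v j = 0}"

definition is_norm_on :: "nat \<Rightarrow> ((nat \<Rightarrow> real) \<Rightarrow> real) \<Rightarrow> bool" where
  "is_norm_on m N \<longleftrightarrow>
     (\<forall>v\<in>real_space m. 0 \<le> N v \<and> (N v = 0 \<longleftrightarrow> v = (\<lambda>_. 0))) \<and>
     (\<forall>v\<in>real_space m. \<forall>a::real. N (\<lambda>j. a * v j) = \<bar>a\<bar> * N v) \<and>
     (\<forall>v\<in>real_space m. \<forall>w\<in>real_space m. N (\<lambda>j. v j + w j) \<le> N v + N w)"

abbreviation cart_power :: "nat \<Rightarrow> (real ^ 'n) set \<Rightarrow> 'n tuple set" where
  "cart_power k E \<equiv> {..<k} \<rightarrow>\<^sub>E E"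

definition diagonal :: "nat \<Rightarrow> (real ^ 'n) set \<Rightarrow> 'n tuple set" where
  "diagonal k \<Omega> = {x \<in> cart_power k \<Omega>. \<forall>i<k. \<forall>j<k. x i = x j}"

text \<open>
  Polynomials in the \<open>nk\<close> scalar variables \<open>x i $ l\<close>. A multi-index gives the exponent of each
  variable \<open>(i, l)\<close>; the coefficients are vectors of \<open>\<real>\<^sup>m\<close>.
\<close>

definition multi_indices :: "nat \<Rightarrow> nat \<Rightarrow> (nat \<times> 'n::finite \<Rightarrow> nat) set" where
  "multi_indices k d = {\<alpha> \<in> {..<k} \<times> UNIV \<rightarrow>\<^sub>E UNIV. sum \<alpha> ({..<k} \<times> UNIV) \<le> d}"

lemma finite_multi_indices: "finite (multi_indices k d :: (nat \<times> 'n::finite \<Rightarrow> nat) set)"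
proof (rule finite_subset)
  show "multi_indices k d \<subseteq> ({..<k} \<times> (UNIV :: 'n set) \<rightarrow>\<^sub>E {..d})"
  proof
    fix \<alpha> :: "nat \<times> 'n \<Rightarrow> nat"
    assume \<alpha>: "\<alpha> \<in> multi_indices k d"
    have "\<alpha> p \<le> d" if "p \<in> {..<k} \<times> UNIV" for p
      using \<alpha> member_le_sum[OF that, of \<alpha>] by (auto simp: multi_indices_def)
    then show "\<alpha> \<in> ({..<k} \<times> UNIV \<rightarrow>\<^sub>E {..d})"
      using \<alpha> by (auto simp: multi_indices_def PiE_iff)
  qed
qed (intro finite_PiE; simp)

definition monomial :: "nat \<Rightarrow> (nat \<times> 'n::finite \<Rightarrow> nat) \<Rightarrow> 'n tuple \<Rightarrow> real" where
  "monomial k \<alpha> x = (\<Prod>(i, l)\<in>{..<k} \<times> UNIV. (x i $ l) ^ \<alpha> (i, l))"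

text \<open>\<open>\<Phi> : \<Omega>\<^sup>k \<rightarrow> \<real>\<^sup>m\<close> is a polynomial of total degree exactly \<open>d\<close>; values of \<open>\<Phi>\<close> outside
  \<open>\<Omega>\<^sup>k\<close> are irrelevant.\<close>

definition polynomial_map ::
    "nat \<Rightarrow> nat \<Rightarrow> nat \<Rightarrow> (real ^ 'n) set \<Rightarrow> ('n tuple \<Rightarrow> nat \<Rightarrow> real) \<Rightarrow> bool" where
  "polynomial_map k m d \<Omega> \<Phi> \<longleftrightarrow>
     (\<exists>c. (\<forall>\<alpha>\<in>multi_indices k d. c \<alpha> \<in> real_space m) \<and>
          (\<exists>\<alpha>\<in>multi_indices k d. sum \<alpha> ({..<k} \<times> UNIV) = d \<and> c \<alpha> \<noteq> (\<lambda>_. 0)) \<and>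
          (\<forall>x\<in>cart_power k \<Omega>. \<forall>j. \<Phi> x j = (\<Sum>\<alpha>\<in>multi_indices k d. c \<alpha> j * monomial k \<alpha> x)))"

text \<open>Iterated partial derivative; each list entry \<open>(i, l)\<close> differentiates once in \<open>x i $ l\<close>.\<close>

fun partial_deriv :: "(nat \<times> 'n::finite) list \<Rightarrow> ('n tuple \<Rightarrow> real) \<Rightarrow> 'n tuple \<Rightarrow> real" where
  "partial_deriv [] f x = f x"
| "partial_deriv ((i, l) # vs) f x =
     deriv (\<lambda>t. partial_deriv vs f (x(i := x i + t *\<^sub>R axis l 1))) 0"

definition vanishes_to_order ::
    "nat \<Rightarrow> nat \<Rightarrow> nat \<Rightarrow> (real ^ 'n) set \<Rightarrow> ('n tuple \<Rightarrow> nat \<Rightarrow> real) \<Rightarrow> bool" where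
  "vanishes_to_order k m q \<Omega> \<Phi> \<longleftrightarrow>
     (\<forall>x\<in>diagonal k \<Omega>. \<forall>vs\<in>lists ({..<k} \<times> UNIV). length vs < q \<longrightarrow>
        (\<forall>j<m. partial_deriv vs (\<lambda>y. \<Phi> y j) x = 0)) \<and>
     (\<exists>x\<in>diagonal k \<Omega>. \<exists>vs\<in>lists ({..<k} \<times> UNIV). length vs = q \<and>
        (\<exists>j<m. partial_deriv vs (\<lambda>y. \<Phi> y j) x \<noteq> 0))"

definition avg_functional ::
    "nat \<Rightarrow> ((nat \<Rightarrow> real) \<Rightarrow> real) \<Rightarrow> ('n tuple \<Rightarrow> nat \<Rightarrow> real) \<Rightarrow> (real ^ 'n) measure \<Rightarrow>
      (real ^ 'n) set \<Rightarrow> ennreal" where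
  "avg_functional k N \<Phi> \<mu> E =
     (\<integral>\<^sup>+ x\<in>cart_power k E. ennreal (N (\<Phi> x)) \<partial>(PiM {..<k} (\<lambda>_. \<mu>)))"

definition sup_functional ::
    "nat \<Rightarrow> ((nat \<Rightarrow> real) \<Rightarrow> real) \<Rightarrow> ('n tuple \<Rightarrow> nat \<Rightarrow> real) \<Rightarrow>
      (real ^ 'n) set \<Rightarrow> ennreal" where
  "sup_functional k N \<Phi> E = (SUP x\<in>cart_power k E. ennreal (N (\<Phi> x)))"

text \<open>Real powers on \<open>[0, \<infinity>]\<close>, meant for exponents \<open>p > 0\<close>.\<close>

definition ennpowr :: "ennreal \<Rightarrow> real \<Rightarrow> ennreal" where
  "ennpowr a p = (if a = \<infinity> then \<infinity> else ennreal (enn2real a powr p))"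

text \<open>\<open>F(E) \<ge> c \<mu>(E)\<^sup>p\<close> for all Borel \<open>E \<subseteq> \<Omega>\<close>, and the best constant for this inequality.
  The best constant is infinite if the inequality holds with every \<open>c\<close>, for instance if \<open>\<mu> = 0\<close>.\<close>

definition power_bound ::
    "(real ^ 'n) set \<Rightarrow> (real ^ 'n) measure \<Rightarrow> real \<Rightarrow> ((real ^ 'n) set \<Rightarrow> ennreal) \<Rightarrow> real \<Rightarrow> bool"
  where
  "power_bound \<Omega> \<mu> p F c \<longleftrightarrow>
     (\<forall>E. E \<in> sets borel \<and> E \<subseteq> \<Omega> \<longrightarrow> F E \<ge> ennreal c * ennpowr (emeasure \<mu> E) p)"

definition best_constant ::
    "(real ^ 'n) set \<Rightarrow> (real ^ 'n) measure \<Rightarrow> real \<Rightarrow> ((real ^ 'n) set \<Rightarrow> ennreal) \<Rightarrow> ennreal"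
  where
  "best_constant \<Omega> \<mu> p F = (SUP c\<in>{c. 0 \<le> c \<and> power_bound \<Omega> \<mu> p F c}. ennreal c)"

end

theory Submission
  imports Defs
begin

text \<open>
  One direction is the trivial inequality \<open>\<A>(E) \<le> \<S>(E) \<mu>(E)\<^sup>k\<close>. For the converse, the point is that on a
  finite-dimensional space of functions the supremum is controlled by the \<open>L\<^sup>1\<close> mean after a small part of the domain has been discarded: every bounded
  Borel \<open>E\<close> of finite positive measure contains a Borel \<open>F\<close> with \<open>\<mu>(F) \<ge> \<mu>(E)/2\<close> such that, for all
  polynomials \<open>P\<close> of degree at most \<open>d\<close> in one point,
  \<open>sup\<^sub>F |P| \<le> K/\<mu>(E) \<integral>\<^sub>E |P| d\<mu>\<close>, with \<open>K\<close> depending only on the dimension of the space of polynomials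
  (\<open>large_subset_sup_le_mean\<close>). Being uniform in \<open>P\<close>, this can be applied in one variable after
  the other (\<open>iterated_mean_bound\<close>) and gives
  \<open>\<S>(F) \<le> C' \<mu>(E)\<^sup>-\<^sup>k \<A>(E)\<close>. If \<open>\<S>(F) \<ge> c' \<mu>(F)\<^sup>s \<ge> c' (\<mu>(E)/2)\<^sup>s\<close>, then
  \<open>\<A>(E) \<ge> c'/(2\<^sup>s C') \<mu>(E)\<^sup>k\<^sup>+\<^sup>s\<close>.

  The set \<open>F\<close> comes from a basis \<open>b\<^sub>1, ..., b\<^sub>q\<close> of the function space that is normalised in \<open>L\<^sup>1(E)\<close> and has
  coordinates bounded by a multiple of the norm (\<open>near_auerbach_basis\<close>): then
  \<open>|P(x)|\<close> is at most a constant times \<open>\<parallel>P\<parallel> \<Sum>|b\<^sub>i(x)|\<close>, and the function \<open>\<Sum>|b\<^sub>i|\<close> has integral at most \<open>q\<close>, so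
  it is of size \<open>q/\<mu>(E)\<close> outside a set of measure \<open>\<mu>(E)/2\<close> by Markov's inequality.

  The same algebraic lemma serves a second time to reduce vector-valued \<open>\<Phi>\<close> to scalar ones. The coefficients
  of \<open>\<Phi>\<close> span a space whose dimension is bounded in terms of \<open>n\<close>, \<open>k\<close>, \<open>d\<close>, so on
  this space the norm is comparable to the sum of the absolute values of boundedly many linear functionals
  (\<open>norm_comparable_to_coordinates\<close>). This is why the constant depends neither on \<open>m\<close> nor
  on the norm.

  Sets of infinite measure and unbounded sets, on which polynomials need not be integrable, are exhausted by
  bounded sets of finite measure. A set \<open>E\<close> of infinite measure is thus treated as the limit of sets of
  measure tending to infinity (\<open>ennpowr_le_if_below\<close>).
\<close>

section \<open>Bases adapted to a seminorm\<close>

definition seminorm :: "(('a \<Rightarrow> real) \<Rightarrow> real) \<Rightarrow> bool" where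
  "seminorm p \<longleftrightarrow>
     (\<forall>t c. p (\<lambda>x. c * t x) = \<bar>c\<bar> * p t) \<and> (\<forall>t u. p (\<lambda>x. t x + u x) \<le> p t + p u)"

definition supported_on :: "'a set \<Rightarrow> ('a \<Rightarrow> real) set" where
  "supported_on A = {t. \<forall>x. x \<notin> A \<longrightarrow> t x = 0}"

lemma seminorm_scale: "seminorm p \<Longrightarrow> p (\<lambda>x. c * t x) = \<bar>c\<bar> * p t"
  by (simp add: seminorm_def)

lemma seminorm_add: "seminorm p \<Longrightarrow> p (\<lambda>x. t x + u x) \<le> p t + p u"
  by (simp add: seminorm_def)

lemma seminorm_zero: "seminorm p \<Longrightarrow> p (\<lambda>x. 0) = 0"
  using seminorm_scale[of p 0] by simp

lemma seminorm_add_scale: "seminorm p \<Longrightarrow> p (\<lambda>x. t x + c * u x) \<le> p t + \<bar>c\<bar> * p u"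
  using seminorm_add[of p t "\<lambda>x. c * u x"] by (simp add: seminorm_scale)

lemma seminorm_diff_scale: "seminorm p \<Longrightarrow> p (\<lambda>x. t x - c * u x) \<le> p t + \<bar>c\<bar> * p u"
  using seminorm_add_scale[of p t "- c" u] by simp

lemma seminorm_nonneg:
  assumes "seminorm p"
  shows "0 \<le> p t"
  using seminorm_diff_scale[OF assms, of t 1 t] seminorm_zero[OF assms] by simp

lemma seminorm_sum:
  assumes "seminorm p" "finite A"
  shows "p (\<lambda>x. \<Sum>i\<in>A. c i * u i x) \<le> (\<Sum>i\<in>A. \<bar>c i\<bar> * p (u i))"
  using assms(2)
proof induction
  case empty
  show ?case using seminorm_zero[OF assms(1)] by simp
next
  case (insert a A)
  have "p (\<lambda>x. (\<Sum>i\<in>A. c i * u i x) + c a * u a x) \<le> p (\<lambda>x. \<Sum>i\<in>A. c i * u i x) + \<bar>c a\<bar> * p (u a)"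
    by (rule seminorm_add_scale[OF assms(1)])
  with insert show ?case by (simp add: add.commute)
qed

text \<open>
  Coordinates with respect to a basis that is almost as good as an Auerbach basis: each basis vector has
  seminorm at most one, and each coordinate is bounded by a multiple of the seminorm. The matrix \<open>g\<close> holds the coefficients
  of the coordinate functionals. A vector is determined by its coordinates only up to
  vectors of seminorm zero.

  The induction adds one unit vector at a time. Let \<open>\<delta>\<close> be its distance from the span of the
  previous ones, and let \<open>w\<close> be its difference from a vector in that span. If \<open>\<delta> > 0\<close>, one chooses \<open>w\<close> of
  seminorm below \<open>2 \<delta>\<close>; projecting along \<open>w\<close> then triples the seminorm at most, which is the source
  of the power of \<open>3\<close>. If \<open>\<delta> = 0\<close>, the coordinates of \<open>w\<close> converge when its seminorm tends to zero, and
  their limits express the new vector, up to seminorm zero, by the old basis.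
\<close>

lemma near_auerbach_basis:
  fixes p :: "('a \<Rightarrow> real) \<Rightarrow> real"
  assumes "seminorm p" and "finite A"
  shows "\<exists>b g. (\<forall>i\<in>A. p (b i) \<le> 1) \<and>
    (\<forall>t\<in>supported_on A.
       (\<forall>i\<in>A. \<bar>\<Sum>\<alpha>\<in>A. t \<alpha> * g i \<alpha>\<bar> \<le> 3 ^ card A * p t) \<and>
       p (\<lambda>x. t x - (\<Sum>i\<in>A. (\<Sum>\<alpha>\<in>A. t \<alpha> * g i \<alpha>) * b i x)) = 0)"
  using assms(2)
proof induction
  case empty
  have "t = (\<lambda>x. 0)" if "t \<in> supported_on {}" for t :: "'a \<Rightarrow> real"
    using that by (auto simp: supported_on_def)
  then show ?case using seminorm_zero[OF assms(1)] by auto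
next
  case (insert a A)
  note p = assms(1)
  from insert.IH obtain b g where
    b: "\<And>i. i \<in> A \<Longrightarrow> p (b i) \<le> 1"
    and bound: "\<And>t i. t \<in> supported_on A \<Longrightarrow> i \<in> A \<Longrightarrow>
        \<bar>\<Sum>\<alpha>\<in>A. t \<alpha> * g i \<alpha>\<bar> \<le> 3 ^ card A * p t"
    and null: "\<And>t. t \<in> supported_on A \<Longrightarrow>
        p (\<lambda>x. t x - (\<Sum>i\<in>A. (\<Sum>\<alpha>\<in>A. t \<alpha> * g i \<alpha>) * b i x)) = 0"
    by blast
  define l where "l t i = (\<Sum>\<alpha>\<in>A. t \<alpha> * g i \<alpha>)" for t i
  note bound = bound[folded l_def] and null = null[folded l_def]
  have l_diff: "l (\<lambda>x. t x - c * w x) i = l t i - c * l w i" for t c w i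
    by (simp add: l_def algebra_simps sum_subtractf sum_distrib_left)
  \<comment> \<open>\<open>W\<close> is the affine space of new vectors. They are normalised at \<open>a\<close>, so that \<open>t - t a \<cdot> w\<close> lies in
      the old space.\<close>
  define W where "W = {w \<in> supported_on (insert a A). w a = 1}"
  have supp: "(\<lambda>x. t x - t a * w x) \<in> supported_on A"
    if "t \<in> supported_on (insert a A)" "w \<in> W" for t w
    unfolding supported_on_def
  proof (intro CollectI allI impI)
    show "t x - t a * w x = 0" if "x \<notin> A" for x
      using \<open>t \<in> _\<close> \<open>w \<in> W\<close> that by (cases "x = a") (auto simp: W_def supported_on_def)
  qed
  define \<delta> where "\<delta> = (INF w\<in>W. p w)"
  have bdd: "bdd_below (p ` W)"
    using seminorm_nonneg[OF p] by (intro bdd_belowI[of _ 0]) auto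
  have W_ne: "W \<noteq> {}"
    by (auto simp: W_def supported_on_def intro!: exI[of _ "\<lambda>x. if x = a then 1 else 0"])
  have \<delta>_le: "\<bar>t a\<bar> * \<delta> \<le> p t" if t: "t \<in> supported_on (insert a A)" for t
  proof (cases "t a = 0")
    case True
    then show ?thesis using seminorm_nonneg[OF p] by simp
  next
    case False
    then have "(\<lambda>x. (1 / t a) * t x) \<in> W" using t by (auto simp: W_def supported_on_def)
    then have "\<delta> \<le> p (\<lambda>x. (1 / t a) * t x)"
      unfolding \<delta>_def by (rule cINF_lower[OF bdd])
    also have "\<dots> = p t / \<bar>t a\<bar>" by (simp only: seminorm_scale[OF p]) simp
    finally show ?thesis using False by (simp add: field_simps)
  qed
  have \<delta>_nonneg: "0 \<le> \<delta>"
    unfolding \<delta>_def using W_ne seminorm_nonneg[OF p] by (intro cINF_greatest) auto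
  \<comment> \<open>The new coordinates: \<open>l\<close> of the projection of \<open>t\<close> along a vector \<open>w\<close> with \<open>w a = 1\<close>, where
      \<open>\<theta> i\<close> is \<open>l w i\<close> or a limit of such values, and a multiple of \<open>t a\<close>.\<close>
  define h where "h \<theta> \<rho> i \<alpha> =
      (if i = a then (if \<alpha> = a then \<rho> else 0) else if \<alpha> = a then - \<theta> i else g i \<alpha>)"
    for \<theta> :: "'a \<Rightarrow> real" and \<rho> :: real and i \<alpha>
  have h_new: "(\<Sum>\<alpha>\<in>insert a A. t \<alpha> * h \<theta> \<rho> a \<alpha>) = t a * \<rho>" for t \<theta> \<rho>
    using insert.hyps by (simp add: h_def sum.neutral if_distrib cong: if_cong)
  have h_old: "(\<Sum>\<alpha>\<in>insert a A. t \<alpha> * h \<theta> \<rho> i \<alpha>) = l t i - t a * \<theta> i" if "i \<in> A" for t \<theta> \<rho> i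
  proof -
    have "i \<noteq> a" using that insert.hyps by auto
    moreover have "(\<Sum>\<alpha>\<in>A. t \<alpha> * h \<theta> \<rho> i \<alpha>) = l t i"
      unfolding l_def using insert.hyps \<open>i \<noteq> a\<close> by (intro sum.cong) (auto simp: h_def)
    ultimately show ?thesis using insert.hyps by (simp add: h_def)
  qed
  have expand: "(\<Sum>i\<in>insert a A. (\<Sum>\<alpha>\<in>insert a A. t \<alpha> * h \<theta> \<rho> i \<alpha>) * (b(a := v)) i x) =
      t a * \<rho> * v x + (\<Sum>i\<in>A. (l t i - t a * \<theta> i) * b i x)" for t \<theta> \<rho> v x
  proof -
    have "(\<Sum>i\<in>A. (\<Sum>\<alpha>\<in>insert a A. t \<alpha> * h \<theta> \<rho> i \<alpha>) * (b(a := v)) i x) =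
        (\<Sum>i\<in>A. (l t i - t a * \<theta> i) * b i x)"
      using insert.hyps h_old by (intro sum.cong) auto
    moreover have "(\<Sum>i\<in>insert a A. (\<Sum>\<alpha>\<in>insert a A. t \<alpha> * h \<theta> \<rho> i \<alpha>) * (b(a := v)) i x) =
        (\<Sum>\<alpha>\<in>insert a A. t \<alpha> * h \<theta> \<rho> a \<alpha>) * (b(a := v)) a x +
        (\<Sum>i\<in>A. (\<Sum>\<alpha>\<in>insert a A. t \<alpha> * h \<theta> \<rho> i \<alpha>) * (b(a := v)) i x)"
      using insert.hyps(1,2) by (rule sum.insert)
    ultimately show ?thesis unfolding h_new by simp
  qed
  have card: "(3::real) ^ card (insert a A) = 3 * 3 ^ card A" using insert.hyps by simp
  have "\<exists>v \<theta> \<rho>. p v \<le> 1 \<and> (\<forall>t\<in>supported_on (insert a A).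
      \<bar>t a * \<rho>\<bar> \<le> 3 * 3 ^ card A * p t \<and>
      (\<forall>i\<in>A. \<bar>l t i - t a * \<theta> i\<bar> \<le> 3 * 3 ^ card A * p t) \<and>
      p (\<lambda>x. t x - (t a * \<rho> * v x + (\<Sum>i\<in>A. (l t i - t a * \<theta> i) * b i x))) = 0)"
  proof (cases "\<delta> = 0")
    case False
    with \<delta>_nonneg have "\<delta> < 2 * \<delta>" by simp
    then have "\<exists>w\<in>W. p w < 2 * \<delta>"
      unfolding \<delta>_def by (subst cINF_less_iff[symmetric]) (use W_ne bdd in auto)
    then obtain w where w: "w \<in> W" "p w < 2 * \<delta>" by blast
    have "\<delta> \<le> p w" unfolding \<delta>_def by (rule cINF_lower[OF bdd w(1)])
    then have pw: "p w > 0" using False \<delta>_nonneg by linarith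
    define v where "v x = (1 / p w) * w x" for x
    have "p v = 1" unfolding v_def by (simp only: seminorm_scale[OF p]) (use pw in simp)
    moreover have "\<bar>t a * p w\<bar> \<le> 3 * 3 ^ card A * p t \<and>
      (\<forall>i\<in>A. \<bar>l t i - t a * l w i\<bar> \<le> 3 * 3 ^ card A * p t) \<and>
      p (\<lambda>x. t x - (t a * p w * v x + (\<Sum>i\<in>A. (l t i - t a * l w i) * b i x))) = 0"
      if t: "t \<in> supported_on (insert a A)" for t
    proof -
      have le2: "\<bar>t a\<bar> * p w \<le> 2 * p t"
        using mult_left_mono[OF less_imp_le[OF w(2)], of "\<bar>t a\<bar>"] \<delta>_le[OF t] by simp
      have "1 * p t \<le> 3 ^ card A * p t"
        by (intro mult_right_mono seminorm_nonneg[OF p]) simp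
      then have c1: "\<bar>t a * p w\<bar> \<le> 3 * 3 ^ card A * p t"
        using le2 pw seminorm_nonneg[OF p, of t] by (simp add: abs_mult)
      have c2: "\<bar>l t i - t a * l w i\<bar> \<le> 3 * 3 ^ card A * p t" if "i \<in> A" for i
      proof -
        have "\<bar>l t i - t a * l w i\<bar> \<le> 3 ^ card A * p (\<lambda>x. t x - t a * w x)"
          using bound[OF supp[OF t w(1)] that] by (simp add: l_diff)
        also have "\<dots> \<le> 3 ^ card A * (3 * p t)"
          using seminorm_diff_scale[OF p, of t "t a" w] le2 by (intro mult_left_mono) auto
        finally show ?thesis by (simp add: mult_ac)
      qed
      have "(\<lambda>x. t x - (t a * p w * v x + (\<Sum>i\<in>A. (l t i - t a * l w i) * b i x))) =
          (\<lambda>x. (t x - t a * w x) - (\<Sum>i\<in>A. l (\<lambda>x. t x - t a * w x) i * b i x))"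
        using pw by (auto simp: v_def l_diff)
      then show ?thesis using null[OF supp[OF t w(1)]] c1 c2 by simp
    qed
    ultimately show ?thesis by (intro exI[of _ v] exI[of _ "l w"] exI[of _ "p w"]) auto
  next
    case True
    have "\<exists>w\<in>W. p w < 1 / real (Suc n)" for n
      using True W_ne bdd unfolding \<delta>_def by (subst cINF_less_iff[symmetric]) auto
    then obtain w where w: "\<And>n. w n \<in> W" "\<And>n. p (w n) < 1 / real (Suc n)" by metis
    have inv0: "(\<lambda>n. 1 / real (Suc n)) \<longlonglongrightarrow> 0" by (rule lim_1_over_n[THEN LIMSEQ_Suc])
    have pw0: "(\<lambda>n. p (w n)) \<longlonglongrightarrow> 0"
      by (rule tendsto_sandwich[OF _ _ tendsto_const inv0])
        (use seminorm_nonneg[OF p] w(2) in \<open>auto intro!: always_eventually less_imp_le\<close>)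
    have "Cauchy (\<lambda>n. l (w n) i)" if i: "i \<in> A" for i
    proof (rule metric_CauchyI)
      fix e :: real assume e: "e > 0"
      have "(\<lambda>n. 3 ^ card A * p (w n)) \<longlonglongrightarrow> 3 ^ card A * 0" by (intro tendsto_intros pw0)
      then have "\<forall>\<^sub>F n in sequentially. 3 ^ card A * p (w n) < e / 2"
        by (rule order_tendstoD(2)) (use e in simp)
      then obtain M where M: "\<And>n. n \<ge> M \<Longrightarrow> 3 ^ card A * p (w n) < e / 2"
        by (auto simp: eventually_sequentially)
      have "dist (l (w m) i) (l (w n) i) < e" if "m \<ge> M" "n \<ge> M" for m n
      proof -
        have s: "w m \<in> supported_on (insert a A)" "w m a = 1" using w(1)[of m] by (auto simp: W_def)
        have "\<bar>l (w m) i - l (w n) i\<bar> \<le> 3 ^ card A * p (\<lambda>x. w m x - 1 * w n x)"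
          using bound[OF supp[OF s(1) w(1)[of n]] i] by (simp add: l_diff s(2) l_diff[of _ 1, simplified])
        also have "\<dots> \<le> 3 ^ card A * (p (w m) + p (w n))"
          using seminorm_diff_scale[OF p, of "w m" 1 "w n"] by (intro mult_left_mono) auto
        also have "\<dots> < e" using M[OF that(1)] M[OF that(2)] by (simp add: algebra_simps)
        finally show ?thesis by (simp add: dist_real_def)
      qed
      then show "\<exists>M. \<forall>m\<ge>M. \<forall>n\<ge>M. dist (l (w m) i) (l (w n) i) < e" by blast
    qed
    then have "\<exists>L. (\<lambda>n. l (w n) i) \<longlonglongrightarrow> L" if "i \<in> A" for i
      using that by (auto simp: Cauchy_convergent_iff convergent_def)
    then obtain \<theta> where \<theta>: "\<And>i. i \<in> A \<Longrightarrow> (\<lambda>n. l (w n) i) \<longlonglongrightarrow> \<theta> i" by metis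
    have "(\<forall>i\<in>A. \<bar>l t i - t a * \<theta> i\<bar> \<le> 3 * 3 ^ card A * p t) \<and>
      p (\<lambda>x. t x - (\<Sum>i\<in>A. (l t i - t a * \<theta> i) * b i x)) = 0"
      if t: "t \<in> supported_on (insert a A)" for t
    proof -
      have c: "\<bar>l t i - t a * \<theta> i\<bar> \<le> 3 * 3 ^ card A * p t" if i: "i \<in> A" for i
      proof -
        have le: "\<bar>l t i - t a * l (w n) i\<bar> \<le> 3 ^ card A * (p t + \<bar>t a\<bar> * p (w n))" for n
        proof -
          have "\<bar>l t i - t a * l (w n) i\<bar> \<le> 3 ^ card A * p (\<lambda>x. t x - t a * w n x)"
            using bound[OF supp[OF t w(1)[of n]] i] by (simp add: l_diff)
          also have "\<dots> \<le> 3 ^ card A * (p t + \<bar>t a\<bar> * p (w n))"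
            using seminorm_diff_scale[OF p, of t "t a" "w n"] by (intro mult_left_mono) auto
          finally show ?thesis .
        qed
        have lim1: "(\<lambda>n. \<bar>l t i - t a * l (w n) i\<bar>) \<longlonglongrightarrow> \<bar>l t i - t a * \<theta> i\<bar>"
          by (intro tendsto_intros \<theta> i)
        have lim2: "(\<lambda>n. 3 ^ card A * (p t + \<bar>t a\<bar> * p (w n))) \<longlonglongrightarrow> 3 ^ card A * (p t + \<bar>t a\<bar> * 0)"
          by (intro tendsto_intros pw0)
        have "\<bar>l t i - t a * \<theta> i\<bar> \<le> 3 ^ card A * (p t + \<bar>t a\<bar> * 0)"
          using le by (intro LIMSEQ_le[OF lim1 lim2]) blast
        also have "\<dots> \<le> 3 * 3 ^ card A * p t" using seminorm_nonneg[OF p, of t] by simp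
        finally show ?thesis .
      qed
      define r where "r x = t x - (\<Sum>i\<in>A. (l t i - t a * \<theta> i) * b i x)" for x
      have le: "p r \<le> \<bar>t a\<bar> * p (w n) + (\<Sum>i\<in>A. \<bar>t a * \<theta> i - t a * l (w n) i\<bar> * p (b i))" for n
      proof -
        define r1 where "r1 x = (t x - t a * w n x) - (\<Sum>i\<in>A. l (\<lambda>x. t x - t a * w n x) i * b i x)" for x
        have "p r1 = 0" unfolding r1_def by (rule null[OF supp[OF t w(1)]])
        define r2 where "r2 x = r1 x + t a * w n x" for x
        have r: "r = (\<lambda>x. r2 x + (\<Sum>i\<in>A. (t a * \<theta> i - t a * l (w n) i) * b i x))"
          by (auto simp: r_def r1_def r2_def l_diff algebra_simps sum_subtractf sum.distrib)
        have "p r \<le> p r2 + p (\<lambda>x. \<Sum>i\<in>A. (t a * \<theta> i - t a * l (w n) i) * b i x)"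
          unfolding r by (rule seminorm_add[OF p])
        moreover have "p r2 \<le> \<bar>t a\<bar> * p (w n)"
          using seminorm_add_scale[OF p, of r1 "t a" "w n"] \<open>p r1 = 0\<close> by (simp add: r2_def[abs_def])
        moreover have "p (\<lambda>x. \<Sum>i\<in>A. (t a * \<theta> i - t a * l (w n) i) * b i x) \<le>
            (\<Sum>i\<in>A. \<bar>t a * \<theta> i - t a * l (w n) i\<bar> * p (b i))"
          by (rule seminorm_sum[OF p insert.hyps(1)])
        ultimately show ?thesis by linarith
      qed
      have lim: "(\<lambda>n. \<bar>t a\<bar> * p (w n) + (\<Sum>i\<in>A. \<bar>t a * \<theta> i - t a * l (w n) i\<bar> * p (b i)))
          \<longlonglongrightarrow> \<bar>t a\<bar> * 0 + (\<Sum>i\<in>A. \<bar>t a * \<theta> i - t a * \<theta> i\<bar> * p (b i))"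
        by (intro tendsto_intros pw0 \<theta>)
      have "p r \<le> \<bar>t a\<bar> * 0 + (\<Sum>i\<in>A. \<bar>t a * \<theta> i - t a * \<theta> i\<bar> * p (b i))"
        using le by (intro LIMSEQ_le_const[OF lim]) blast
      then have "p r = 0" using seminorm_nonneg[OF p, of r] by simp
      then show ?thesis using c by (simp add: r_def[abs_def])
    qed
    then show ?thesis using seminorm_nonneg[OF p] seminorm_zero[OF p]
      by (intro exI[of _ "\<lambda>x. 0"] exI[of _ \<theta>] exI[of _ 0]) auto
  qed
  then obtain v \<theta> \<rho> where v: "p v \<le> 1" and
    t: "\<And>t. t \<in> supported_on (insert a A) \<Longrightarrow> \<bar>t a * \<rho>\<bar> \<le> 3 * 3 ^ card A * p t \<and>
      (\<forall>i\<in>A. \<bar>l t i - t a * \<theta> i\<bar> \<le> 3 * 3 ^ card A * p t) \<and>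
      p (\<lambda>x. t x - (t a * \<rho> * v x + (\<Sum>i\<in>A. (l t i - t a * \<theta> i) * b i x))) = 0"
    by blast
  show ?case
  proof (rule exI[of _ "b(a := v)"], rule exI[of _ "h \<theta> \<rho>"], intro conjI ballI)
    show "p ((b(a := v)) i) \<le> 1" if "i \<in> insert a A" for i using that v b by auto
  next
    fix t i assume "t \<in> supported_on (insert a A)" "i \<in> insert a A"
    then show "\<bar>\<Sum>\<alpha>\<in>insert a A. t \<alpha> * h \<theta> \<rho> i \<alpha>\<bar> \<le> 3 ^ card (insert a A) * p t"
      using t[of t] h_new[of t] h_old[of i t] unfolding card by (cases "i = a") auto
  next
    fix t assume "t \<in> supported_on (insert a A)"
    then show "p (\<lambda>x. t x - (\<Sum>i\<in>insert a A. (\<Sum>\<alpha>\<in>insert a A. t \<alpha> * h \<theta> \<rho> i \<alpha>) * (b(a := v)) i x)) = 0"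
      using t[of t] unfolding expand by auto
  qed
qed

section \<open>Norms on coefficients of vector-valued functions\<close>

text \<open>
  Transporting the norm to the space of coefficients \<open>t\<close> gives a seminorm there, and the
  coordinates of \<open>near_auerbach_basis\<close> are the functionals required. The constant depends on the number of
  vectors \<open>c \<alpha>\<close> and not on the dimension of the space that contains them.
\<close>

lemma norm_comparable_to_coordinates:
  fixes c :: "'a \<Rightarrow> nat \<Rightarrow> real"
  assumes N: "is_norm_on m N" and A: "finite A" and c: "\<forall>\<alpha>\<in>A. c \<alpha> \<in> real_space m"
  shows "\<exists>g. \<forall>t. N (\<lambda>j. \<Sum>\<alpha>\<in>A. t \<alpha> * c \<alpha> j) \<le> (\<Sum>i\<in>A. \<bar>\<Sum>\<alpha>\<in>A. g i \<alpha> * t \<alpha>\<bar>) \<and>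
    (\<forall>i\<in>A. \<bar>\<Sum>\<alpha>\<in>A. g i \<alpha> * t \<alpha>\<bar> \<le> 3 ^ card A * N (\<lambda>j. \<Sum>\<alpha>\<in>A. t \<alpha> * c \<alpha> j))"
proof -
  define p where "p t = N (\<lambda>j. \<Sum>\<alpha>\<in>A. t \<alpha> * c \<alpha> j)" for t
  have mem: "(\<lambda>j. \<Sum>\<alpha>\<in>A. t \<alpha> * c \<alpha> j) \<in> real_space m" for t
    using c by (auto simp: real_space_def intro!: sum.neutral)
  have p: "seminorm p"
    unfolding seminorm_def
  proof (intro conjI allI)
    fix t x
    have "p (\<lambda>\<alpha>. x * t \<alpha>) = N (\<lambda>j. x * (\<Sum>\<alpha>\<in>A. t \<alpha> * c \<alpha> j))"
      by (simp add: p_def sum_distrib_left mult_ac)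
    also have "\<dots> = \<bar>x\<bar> * p t" using N mem[of t] by (simp add: is_norm_on_def p_def)
    finally show "p (\<lambda>\<alpha>. x * t \<alpha>) = \<bar>x\<bar> * p t" .
  next
    fix t u
    have "p (\<lambda>\<alpha>. t \<alpha> + u \<alpha>) = N (\<lambda>j. (\<Sum>\<alpha>\<in>A. t \<alpha> * c \<alpha> j) + (\<Sum>\<alpha>\<in>A. u \<alpha> * c \<alpha> j))"
      by (simp add: p_def algebra_simps sum.distrib)
    also have "\<dots> \<le> p t + p u" using N mem[of t] mem[of u] by (simp add: is_norm_on_def p_def)
    finally show "p (\<lambda>\<alpha>. t \<alpha> + u \<alpha>) \<le> p t + p u" .
  qed
  from near_auerbach_basis[OF this A] obtain b g where
    b: "\<And>i. i \<in> A \<Longrightarrow> p (b i) \<le> 1" and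
    bound: "\<And>t i. t \<in> supported_on A \<Longrightarrow> i \<in> A \<Longrightarrow>
        \<bar>\<Sum>\<alpha>\<in>A. t \<alpha> * g i \<alpha>\<bar> \<le> 3 ^ card A * p t" and
    null: "\<And>t. t \<in> supported_on A \<Longrightarrow>
        p (\<lambda>x. t x - (\<Sum>i\<in>A. (\<Sum>\<alpha>\<in>A. t \<alpha> * g i \<alpha>) * b i x)) = 0"
    by blast
  have "p t \<le> (\<Sum>i\<in>A. \<bar>\<Sum>\<alpha>\<in>A. g i \<alpha> * t \<alpha>\<bar>) \<and> (\<forall>i\<in>A. \<bar>\<Sum>\<alpha>\<in>A. g i \<alpha> * t \<alpha>\<bar> \<le> 3 ^ card A * p t)" for t
  proof -
    define t' where "t' \<alpha> = (if \<alpha> \<in> A then t \<alpha> else 0)" for \<alpha>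
    have t': "t' \<in> supported_on A" by (auto simp: t'_def supported_on_def)
    have pt: "p t' = p t" unfolding p_def by (intro arg_cong[where f=N] ext sum.cong) (auto simp: t'_def)
    have l: "(\<Sum>\<alpha>\<in>A. t' \<alpha> * g i \<alpha>) = (\<Sum>\<alpha>\<in>A. g i \<alpha> * t \<alpha>)" for i
      by (intro sum.cong) (auto simp: t'_def)
    have "p t' \<le> p (\<lambda>x. t' x - (\<Sum>i\<in>A. (\<Sum>\<alpha>\<in>A. t' \<alpha> * g i \<alpha>) * b i x)) +
        p (\<lambda>x. \<Sum>i\<in>A. (\<Sum>\<alpha>\<in>A. t' \<alpha> * g i \<alpha>) * b i x)"
      using seminorm_add[OF p, of "\<lambda>x. t' x - (\<Sum>i\<in>A. (\<Sum>\<alpha>\<in>A. t' \<alpha> * g i \<alpha>) * b i x)"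
        "\<lambda>x. \<Sum>i\<in>A. (\<Sum>\<alpha>\<in>A. t' \<alpha> * g i \<alpha>) * b i x"] by simp
    also have "\<dots> \<le> (\<Sum>i\<in>A. \<bar>\<Sum>\<alpha>\<in>A. t' \<alpha> * g i \<alpha>\<bar> * p (b i))"
      using null[OF t'] seminorm_sum[OF p A, of "\<lambda>i. \<Sum>\<alpha>\<in>A. t' \<alpha> * g i \<alpha>" b] by simp
    also have "\<dots> \<le> (\<Sum>i\<in>A. \<bar>\<Sum>\<alpha>\<in>A. t' \<alpha> * g i \<alpha>\<bar> * 1)"
      using b by (intro sum_mono mult_left_mono) auto
    finally show ?thesis using bound[OF t'] by (simp add: l pt)
  qed
  then show ?thesis unfolding p_def by (intro exI[of _ g] allI)
qed

section \<open>Supremum and mean on finite-dimensional function spaces\<close>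

lemma sum_mult_sum_swap:
  fixes t :: "'a \<Rightarrow> real"
  shows "(\<Sum>\<alpha>\<in>A. t \<alpha> * (\<Sum>i\<in>B. g i \<alpha> * v i)) = (\<Sum>i\<in>B. (\<Sum>\<alpha>\<in>A. t \<alpha> * g i \<alpha>) * v i)"
  unfolding sum_distrib_left sum_distrib_right by (subst sum.swap) (simp add: mult_ac)

definition comparability_const :: "nat \<Rightarrow> real" where
  "comparability_const q = 2 * (q + 1) * 3 ^ q"

lemma comparability_const_pos: "comparability_const q > 0"
  by (simp add: comparability_const_def add_pos_nonneg)

text \<open>
  With \<open>b\<close> an adapted basis for the \<open>L\<^sup>1\<close> seminorm on coefficients, a constant multiple of the function
  \<open>\<Gamma> = \<Sum>|b\<^sub>i|\<close> dominates every combination of seminorm one, and its integral is at most \<open>card A\<close>. Hence \<open>\<Gamma>\<close> is small on half of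
  the space, uniformly over all combinations. Combinations that vanish almost everywhere
  have seminorm zero; it suffices to control finitely many of them, so that a single null set can be removed.
\<close>

lemma large_subset_sup_le_mean:
  fixes e :: "'a \<Rightarrow> 'x \<Rightarrow> real"
  assumes "finite_measure M" and "finite A" and pos: "measure M (space M) > 0"
    and integrable: "\<And>\<alpha>. \<alpha> \<in> A \<Longrightarrow> integrable M (e \<alpha>)"
  shows "\<exists>F\<in>sets M. measure M (space M) / 2 \<le> measure M F \<and>
    (\<forall>t. \<forall>x\<in>F. \<bar>\<Sum>\<alpha>\<in>A. t \<alpha> * e \<alpha> x\<bar> \<le>
       comparability_const (card A) / measure M (space M) * (\<integral>x. \<bar>\<Sum>\<alpha>\<in>A. t \<alpha> * e \<alpha> x\<bar> \<partial>M))"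
proof -
  interpret finite_measure M by fact
  define m where "m = measure M (space M)"
  define ev where "ev x t = (\<Sum>\<alpha>\<in>A. t \<alpha> * e \<alpha> x)" for x and t :: "'a \<Rightarrow> real"
  define p where "p t = (\<integral>x. \<bar>ev x t\<bar> \<partial>M)" for t
  have int_ev: "integrable M (\<lambda>x. ev x t)" for t
    unfolding ev_def using integrable by auto
  have "seminorm p"
    unfolding seminorm_def
  proof (intro conjI allI)
    fix t c
    have "ev x (\<lambda>x. c * t x) = c * ev x t" for x
      by (simp add: ev_def sum_distrib_left mult_ac)
    then show "p (\<lambda>x. c * t x) = \<bar>c\<bar> * p t" by (simp add: p_def abs_mult)
  next
    fix t u
    have "ev x (\<lambda>x. t x + u x) = ev x t + ev x u" for x
      by (simp add: ev_def algebra_simps sum.distrib)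
    then have "p (\<lambda>x. t x + u x) \<le> (\<integral>x. \<bar>ev x t\<bar> + \<bar>ev x u\<bar> \<partial>M)"
      unfolding p_def by (intro integral_mono) (auto intro!: integrable_abs int_ev Bochner_Integration.integrable_add)
    also have "\<dots> = p t + p u"
      unfolding p_def by (intro Bochner_Integration.integral_add integrable_abs int_ev)
    finally show "p (\<lambda>x. t x + u x) \<le> p t + p u" .
  qed
  from near_auerbach_basis[OF this \<open>finite A\<close>] obtain b g where
    b: "\<And>i. i \<in> A \<Longrightarrow> p (b i) \<le> 1" and
    bound: "\<And>t i. t \<in> supported_on A \<Longrightarrow> i \<in> A \<Longrightarrow>
        \<bar>\<Sum>\<alpha>\<in>A. t \<alpha> * g i \<alpha>\<bar> \<le> 3 ^ card A * p t" and
    null: "\<And>t. t \<in> supported_on A \<Longrightarrow>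
        p (\<lambda>x. t x - (\<Sum>i\<in>A. (\<Sum>\<alpha>\<in>A. t \<alpha> * g i \<alpha>) * b i x)) = 0"
    by blast
  define \<Gamma> where "\<Gamma> x = (\<Sum>i\<in>A. \<bar>ev x (b i)\<bar>)" for x
  \<comment> \<open>The summand \<open>1\<close> keeps the threshold positive when \<open>A\<close> is empty.\<close>
  define c where "c = 2 * (card A + 1) / m"
  have m: "m > 0" using pos by (simp add: m_def)
  then have c: "c > 0" by (simp add: c_def)
  have int_\<Gamma>: "integrable M \<Gamma>"
    unfolding \<Gamma>_def by (intro Bochner_Integration.integrable_sum integrable_abs int_ev)
  then have [measurable]: "\<Gamma> \<in> borel_measurable M" by auto
  have "(\<integral>x. \<Gamma> x \<partial>M) = (\<Sum>i\<in>A. p (b i))"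
    unfolding \<Gamma>_def p_def by (intro Bochner_Integration.integral_sum integrable_abs int_ev)
  also have "\<dots> \<le> card A" using sum_mono[of A "\<lambda>i. p (b i)" "\<lambda>_. 1"] b by simp
  finally have \<Gamma>_le: "(\<integral>x. \<Gamma> x \<partial>M) \<le> card A" .
  have "measure M {x \<in> space M. \<Gamma> x \<ge> c} \<le> (\<integral>x. \<Gamma> x \<partial>M) / c"
    by (rule integral_Markov_inequality_measure[OF int_\<Gamma> sets.top _ c])
      (auto simp: \<Gamma>_def intro!: AE_I2 sum_nonneg)
  also have "\<dots> \<le> card A / c" using \<Gamma>_le c by (intro divide_right_mono) auto
  also have "\<dots> \<le> m / 2" using m by (simp add: c_def field_simps)
  finally have bad: "measure M {x \<in> space M. \<Gamma> x \<ge> c} \<le> m / 2" .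
  define F0 where "F0 = {x \<in> space M. \<Gamma> x < c}"
  have "F0 = space M - {x \<in> space M. \<Gamma> x \<ge> c}" by (auto simp: F0_def)
  then have F0: "measure M F0 \<ge> m / 2"
    using bad by (simp add: finite_measure_compl m_def)
  \<comment> \<open>On a set of full measure, the \<open>e \<alpha>\<close> are the combinations of the \<open>b i\<close> that the coordinates
      prescribe.\<close>
  define r where "r \<alpha> \<beta> = (if \<beta> = \<alpha> then 1 else 0) - (\<Sum>i\<in>A. g i \<alpha> * b i \<beta>)" for \<alpha> \<beta>
  have ev_r: "ev x (r \<alpha>) = e \<alpha> x - (\<Sum>i\<in>A. g i \<alpha> * ev x (b i))" if "\<alpha> \<in> A" for x \<alpha>
  proof -
    have "ev x (r \<alpha>) = (\<Sum>\<beta>\<in>A. (if \<beta> = \<alpha> then 1 else 0) * e \<beta> x) -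
        (\<Sum>\<beta>\<in>A. e \<beta> x * (\<Sum>i\<in>A. b i \<beta> * g i \<alpha>))"
      by (simp add: ev_def r_def algebra_simps sum_subtractf)
    also have "(\<Sum>\<beta>\<in>A. (if \<beta> = \<alpha> then 1 else 0) * e \<beta> x) = e \<alpha> x"
      using \<open>finite A\<close> that by (simp add: if_distrib[of "\<lambda>y. y * _"] cong: if_cong)
    also have "(\<Sum>\<beta>\<in>A. e \<beta> x * (\<Sum>i\<in>A. b i \<beta> * g i \<alpha>)) = (\<Sum>i\<in>A. g i \<alpha> * ev x (b i))"
      unfolding ev_def sum_mult_sum_swap[where t="\<lambda>\<beta>. e \<beta> x"] by (intro sum.cong) (auto simp: mult_ac)
    finally show ?thesis .
  qed
  have "AE x in M. ev x (r \<alpha>) = 0" if \<alpha>: "\<alpha> \<in> A" for \<alpha>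
  proof -
    have "(\<lambda>\<beta>. if \<beta> = \<alpha> then 1 else 0) \<in> supported_on A" using \<alpha> by (auto simp: supported_on_def)
    from null[OF this] have "p (r \<alpha>) = 0"
      using \<alpha> \<open>finite A\<close> by (simp add: r_def[abs_def] if_distrib[of "\<lambda>y. y * _"] cong: if_cong)
    then have "AE x in M. \<bar>ev x (r \<alpha>)\<bar> = 0"
      unfolding p_def by (subst (asm) integral_nonneg_eq_0_iff_AE) (auto intro!: integrable_abs int_ev)
    then show ?thesis by simp
  qed
  then have ae: "AE x in M. \<forall>\<alpha>\<in>A. ev x (r \<alpha>) = 0"
    using \<open>finite A\<close> by (simp add: AE_finite_all)
  define F where "F = {x \<in> F0. \<forall>\<alpha>\<in>A. ev x (r \<alpha>) = 0}"
  have [measurable]: "(\<lambda>x. ev x t) \<in> borel_measurable M" for t using int_ev by auto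
  have F_eq: "F = {x \<in> space M. \<Gamma> x < c \<and> (\<forall>\<alpha>\<in>A. ev x (r \<alpha>) = 0)}"
    by (auto simp: F_def F0_def)
  have F_sets: "F \<in> sets M" unfolding F_eq using \<open>finite A\<close> by measurable
  moreover have "F0 \<in> sets M" unfolding F0_def by measurable
  ultimately have "measure M F = measure M F0"
    using ae by (intro measure_eq_AE) (auto simp: F_def)
  moreover have "\<bar>ev x t\<bar> \<le> comparability_const (card A) / m * p t" if x: "x \<in> F" for x t
  proof -
    define t' where "t' \<alpha> = (if \<alpha> \<in> A then t \<alpha> else 0)" for \<alpha>
    have ev_t': "ev y t' = ev y t" for y
      by (auto simp: ev_def t'_def intro!: sum.cong)
    then have p_t': "p t' = p t" by (simp add: p_def)
    have t': "t' \<in> supported_on A" by (auto simp: t'_def supported_on_def)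
    have "e \<alpha> x = (\<Sum>i\<in>A. g i \<alpha> * ev x (b i))" if "\<alpha> \<in> A" for \<alpha>
      using x ev_r[OF that, of x] that by (auto simp: F_def)
    then have "ev x t' = (\<Sum>\<alpha>\<in>A. t' \<alpha> * (\<Sum>i\<in>A. g i \<alpha> * ev x (b i)))"
      unfolding ev_def[of x t'] by (intro sum.cong) auto
    also have "\<dots> = (\<Sum>i\<in>A. (\<Sum>\<alpha>\<in>A. t' \<alpha> * g i \<alpha>) * ev x (b i))" by (rule sum_mult_sum_swap)
    finally have "\<bar>ev x t\<bar> \<le> (\<Sum>i\<in>A. \<bar>\<Sum>\<alpha>\<in>A. t' \<alpha> * g i \<alpha>\<bar> * \<bar>ev x (b i)\<bar>)"
      unfolding ev_t' by (simp add: order.trans[OF sum_abs] abs_mult)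
    also have "\<dots> \<le> (\<Sum>i\<in>A. 3 ^ card A * p t * \<bar>ev x (b i)\<bar>)"
      using bound[OF t'] by (intro sum_mono mult_right_mono) (auto simp: p_t')
    also have "\<dots> = 3 ^ card A * p t * \<Gamma> x" by (simp add: \<Gamma>_def sum_distrib_left)
    also have "\<dots> \<le> 3 ^ card A * p t * c"
      using x by (intro mult_left_mono) (auto simp: F_def F0_def p_def)
    finally show ?thesis by (simp add: c_def comparability_const_def field_simps)
  qed
  ultimately show ?thesis
    using F_sets F0 unfolding m_def p_def ev_def by (intro bexI[of _ F]) auto
qed

section \<open>Means over several variables\<close>

text \<open>
  A bound of the value at a point of \<open>F\<close> by the mean over \<open>E\<close> in one variable, whatever the other
  variables are, can be used for all variables in turn: once the first \<open>j\<close> variables are integrated over \<open>E\<close>, variable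
  \<open>j\<close> is still at its original place in \<open>F\<close>.
\<close>

lemma iterated_mean_bound:
  fixes f :: "(nat \<Rightarrow> 'x) \<Rightarrow> ennreal"
  assumes "sigma_finite_measure M" and E[measurable]: "E \<in> sets M"
    and meas: "\<And>x j. (\<lambda>y. f (\<lambda>i. if i < j then y i else x i)) \<in> borel_measurable (PiM {..<j} (\<lambda>_. M))"
    and one: "\<And>x j. j < k \<Longrightarrow> x j \<in> F \<Longrightarrow> f x \<le> B * (\<integral>\<^sup>+z\<in>E. f (x(j := z)) \<partial>M)"
    and x: "\<And>i. i < k \<Longrightarrow> x i \<in> F"
  shows "f x \<le> B ^ k * (\<integral>\<^sup>+y\<in>{..<k} \<rightarrow>\<^sub>E E. f (\<lambda>i. if i < k then y i else x i) \<partial>(PiM {..<k} (\<lambda>_. M)))"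
proof -
  interpret sigma_finite_measure M by fact
  interpret product_sigma_finite "\<lambda>_::nat. M" by standard
  define T where "T j y i = (if i < j then y i else x i)" for j and y :: "nat \<Rightarrow> 'x" and i
  have "f x \<le> B ^ j * (\<integral>\<^sup>+y\<in>{..<j} \<rightarrow>\<^sub>E E. f (T j y) \<partial>(PiM {..<j} (\<lambda>_. M)))" if "j \<le> k" for j
    using that
  proof (induction j)
    case 0
    then show ?case by (simp add: nn_integral_empty T_def)
  next
    case (Suc j)
    have *: "{..<Suc j} = insert j {..<j}" by auto
    have [measurable]: "(\<lambda>y. f (T j y)) \<in> borel_measurable (PiM {..<j} (\<lambda>_. M))" for j :: nat
      unfolding T_def by (rule meas)
    have [measurable]: "({..<j} \<rightarrow>\<^sub>E E) \<in> sets (PiM {..<j} (\<lambda>_. M))" for j :: nat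
      by (intro sets_PiM_I_finite) auto
    have "(\<integral>\<^sup>+y\<in>{..<j} \<rightarrow>\<^sub>E E. f (T j y) \<partial>(PiM {..<j} (\<lambda>_. M))) \<le>
        (\<integral>\<^sup>+y. B * (\<integral>\<^sup>+z. f (T (Suc j) (y(j := z))) * indicator ({..<Suc j} \<rightarrow>\<^sub>E E) (y(j := z)) \<partial>M)
           \<partial>(PiM {..<j} (\<lambda>_. M)))"
    proof (rule nn_integral_mono)
      fix y assume y: "y \<in> space (PiM {..<j} (\<lambda>_. M))"
      have upd: "(T j y)(j := z) = T (Suc j) (y(j := z))" for z
        by (auto simp: T_def fun_eq_iff)
      have ind: "indicator ({..<Suc j} \<rightarrow>\<^sub>E E) (y(j := z)) = (indicator E z :: ennreal)"
        if "y \<in> {..<j} \<rightarrow>\<^sub>E E" for z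
        using that by (auto simp: indicator_def PiE_iff extensional_def lessThan_Suc)
      show "f (T j y) * indicator ({..<j} \<rightarrow>\<^sub>E E) y \<le>
          B * (\<integral>\<^sup>+z. f (T (Suc j) (y(j := z))) * indicator ({..<Suc j} \<rightarrow>\<^sub>E E) (y(j := z)) \<partial>M)"
      proof (cases "y \<in> {..<j} \<rightarrow>\<^sub>E E")
        case True
        have "f (T j y) \<le> B * (\<integral>\<^sup>+z\<in>E. f ((T j y)(j := z)) \<partial>M)"
          using x Suc.prems by (intro one) (auto simp: T_def)
        then show ?thesis using True by (simp add: upd ind)
      qed simp
    qed
    also have "\<dots> = B * (\<integral>\<^sup>+y. (\<integral>\<^sup>+z. f (T (Suc j) (y(j := z))) * indicator ({..<Suc j} \<rightarrow>\<^sub>E E) (y(j := z)) \<partial>M)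
           \<partial>(PiM {..<j} (\<lambda>_. M)))"
    proof (rule nn_integral_cmult)
      have "(\<lambda>y. f (T (Suc j) y) * indicator ({..<Suc j} \<rightarrow>\<^sub>E E) y) \<in> borel_measurable (PiM (insert j {..<j}) (\<lambda>_. M))"
        unfolding *[symmetric] by measurable
      from measurable_compose[OF measurable_add_dim this]
      have "(\<lambda>(y, z). f (T (Suc j) (y(j := z))) * indicator ({..<Suc j} \<rightarrow>\<^sub>E E) (y(j := z)))
          \<in> borel_measurable (PiM {..<j} (\<lambda>_. M) \<Otimes>\<^sub>M M)"
        by (simp add: case_prod_beta)
      then show "(\<lambda>y. \<integral>\<^sup>+z. f (T (Suc j) (y(j := z))) * indicator ({..<Suc j} \<rightarrow>\<^sub>E E) (y(j := z)) \<partial>M)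
          \<in> borel_measurable (PiM {..<j} (\<lambda>_. M))"
        by (rule borel_measurable_nn_integral)
    qed
    also have "(\<integral>\<^sup>+y. (\<integral>\<^sup>+z. f (T (Suc j) (y(j := z))) * indicator ({..<Suc j} \<rightarrow>\<^sub>E E) (y(j := z)) \<partial>M)
           \<partial>(PiM {..<j} (\<lambda>_. M))) =
        (\<integral>\<^sup>+y\<in>{..<Suc j} \<rightarrow>\<^sub>E E. f (T (Suc j) y) \<partial>(PiM {..<Suc j} (\<lambda>_. M)))"
      unfolding * by (rule product_nn_integral_insert[symmetric]) (auto simp: *[symmetric])
    finally have "B ^ j * (\<integral>\<^sup>+y\<in>{..<j} \<rightarrow>\<^sub>E E. f (T j y) \<partial>(PiM {..<j} (\<lambda>_. M))) \<le>
      B ^ j * (B * (\<integral>\<^sup>+y\<in>{..<Suc j} \<rightarrow>\<^sub>E E. f (T (Suc j) y) \<partial>(PiM {..<Suc j} (\<lambda>_. M))))"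
      by (rule mult_left_mono) simp
    with Suc show ?case by (simp add: mult_ac)
  qed
  from this[OF order.refl] show ?thesis unfolding T_def .
qed

section \<open>Polynomials in several points\<close>

definition exponents :: "nat \<Rightarrow> ('n::finite \<Rightarrow> nat) set" where
  "exponents d = {\<beta>. sum \<beta> UNIV \<le> d}"

definition point_monomial :: "('n::finite \<Rightarrow> nat) \<Rightarrow> real ^ 'n \<Rightarrow> real" where
  "point_monomial \<beta> z = (\<Prod>l\<in>UNIV. (z $ l) ^ \<beta> l)"

lemma finite_exponents: "finite (exponents d :: ('n::finite \<Rightarrow> nat) set)"
proof (rule finite_subset)
  show "exponents d \<subseteq> ((UNIV :: 'n set) \<rightarrow>\<^sub>E {..d})"
  proof
    fix \<beta> :: "'n \<Rightarrow> nat" assume "\<beta> \<in> exponents d"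
    then have "\<beta> l \<le> d" for l
      using member_le_sum[of l UNIV \<beta>] by (auto simp: exponents_def)
    then show "\<beta> \<in> (UNIV :: 'n set) \<rightarrow>\<^sub>E {..d}" by auto
  qed
qed (intro finite_PiE; simp)

lemma continuous_point_monomial: "continuous_on S (point_monomial \<beta>)"
  unfolding point_monomial_def by (intro continuous_intros)

lemma monomial_update:
  assumes "j < k"
  shows "monomial k \<alpha> (x(j := z)) =
    (\<Prod>(i, l)\<in>({..<k} - {j}) \<times> UNIV. (x i $ l) ^ \<alpha> (i, l)) * point_monomial (\<lambda>l. \<alpha> (j, l)) z"
proof -
  have "{..<k} \<times> UNIV = ({..<k} - {j}) \<times> UNIV \<union> {j} \<times> (UNIV :: 'a set)" using assms by auto
  then have "monomial k \<alpha> (x(j := z)) =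
      (\<Prod>(i, l)\<in>({..<k} - {j}) \<times> UNIV. ((x(j := z)) i $ l) ^ \<alpha> (i, l)) *
      (\<Prod>(i, l)\<in>{j} \<times> UNIV. ((x(j := z)) i $ l) ^ \<alpha> (i, l))"
    unfolding monomial_def by (simp only:) (rule prod.union_disjoint; auto)
  also have "(\<Prod>(i, l)\<in>({..<k} - {j}) \<times> UNIV. ((x(j := z)) i $ l) ^ \<alpha> (i, l)) =
      (\<Prod>(i, l)\<in>({..<k} - {j}) \<times> UNIV. (x i $ l) ^ \<alpha> (i, l))"
    by (rule prod.cong[OF refl]) (clarsimp simp: case_prod_beta)
  also have "(\<Prod>(i, l)\<in>{j} \<times> UNIV. ((x(j := z)) i $ l) ^ \<alpha> (i, l)) = point_monomial (\<lambda>l. \<alpha> (j, l)) z"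
    unfolding point_monomial_def
    by (rule prod.reindex_bij_witness[of _ "\<lambda>l. (j, l)" snd]) auto
  finally show ?thesis .
qed

lemma slice_in_exponents:
  assumes "\<alpha> \<in> multi_indices k d" "j < k"
  shows "(\<lambda>l. \<alpha> (j, l)) \<in> exponents d"
proof -
  have "(\<Sum>l\<in>UNIV. \<alpha> (j, l)) = sum \<alpha> ({j} \<times> UNIV)"
    by (rule sum.reindex_bij_witness[of _ snd "\<lambda>l. (j, l)"]) auto
  also have "\<dots> \<le> sum \<alpha> ({..<k} \<times> UNIV)"
    using assms by (intro sum_mono2) auto
  finally show ?thesis using assms by (auto simp: multi_indices_def exponents_def)
qed

text \<open>
  As a function of one of its points, a polynomial lies in the span of the monomials of degree at most \<open>d\<close> in that point,
  a space which does not depend on the other points. This makes a single large set work for all of them.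
\<close>

lemma polynomial_slice:
  fixes c :: "(nat \<times> 'n::finite \<Rightarrow> nat) \<Rightarrow> real" and x :: "'n tuple"
  assumes "j < k"
  shows "\<exists>t. \<forall>z. (\<Sum>\<alpha>\<in>multi_indices k d. c \<alpha> * monomial k \<alpha> (x(j := z))) =
    (\<Sum>\<beta>\<in>exponents d. t \<beta> * point_monomial \<beta> z)"
proof -
  define w where "w \<alpha> = c \<alpha> * (\<Prod>(i, l)\<in>({..<k} - {j}) \<times> UNIV. (x i $ l) ^ \<alpha> (i, l))" for \<alpha>
  define t where "t \<beta> = (\<Sum>\<alpha>\<in>{\<alpha> \<in> multi_indices k d. (\<lambda>l. \<alpha> (j, l)) = \<beta>}. w \<alpha>)" for \<beta>
  have "(\<Sum>\<alpha>\<in>multi_indices k d. c \<alpha> * monomial k \<alpha> (x(j := z))) =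
    (\<Sum>\<beta>\<in>exponents d. t \<beta> * point_monomial \<beta> z)" for z
  proof -
    have "(\<Sum>\<alpha>\<in>multi_indices k d. c \<alpha> * monomial k \<alpha> (x(j := z))) =
        (\<Sum>\<alpha>\<in>multi_indices k d. w \<alpha> * point_monomial (\<lambda>l. \<alpha> (j, l)) z)"
      by (simp add: monomial_update[OF assms] w_def mult_ac)
    also have "\<dots> = (\<Sum>\<beta>\<in>exponents d. \<Sum>\<alpha>\<in>{\<alpha> \<in> multi_indices k d. (\<lambda>l. \<alpha> (j, l)) = \<beta>}.
        w \<alpha> * point_monomial (\<lambda>l. \<alpha> (j, l)) z)"
      using slice_in_exponents[OF _ assms]
      by (intro sum.group[symmetric] finite_multi_indices finite_exponents) auto
    also have "\<dots> = (\<Sum>\<beta>\<in>exponents d. t \<beta> * point_monomial \<beta> z)"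
      unfolding t_def sum_distrib_right by (intro sum.cong) auto
    finally show ?thesis .
  qed
  then show ?thesis by blast
qed

lemma monomial_restrict:
  "monomial k \<alpha> (\<lambda>i. if i < k then y i else x i) = monomial k \<alpha> y"
  unfolding monomial_def by (intro prod.cong) auto

lemma borel_measurable_id_subspace:
  fixes \<mu> :: "'a::topological_space measure"
  assumes "sets \<mu> = sets (restrict_space borel \<Omega>)"
  shows "(\<lambda>z. z) \<in> borel_measurable \<mu>"
  by (subst measurable_cong_sets[OF assms refl]) (rule measurable_restrict_space1, simp)

lemma borel_measurable_polynomial_merge:
  fixes \<mu> :: "(real ^ 'n::finite) measure" and j :: nat
  assumes "sets \<mu> = sets (restrict_space borel \<Omega>)"
  shows "(\<lambda>y. \<Sum>\<alpha>\<in>multi_indices k d. c \<alpha> * monomial k \<alpha> (\<lambda>i. if i < j then y i else x i))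
    \<in> borel_measurable (PiM {..<j} (\<lambda>_. \<mu>))"
proof -
  have "(\<lambda>y. (if i < j then y i else x i) $ l) \<in> borel_measurable (PiM {..<j} (\<lambda>_. \<mu>))" for i l
  proof (cases "i < j")
    case True
    then have "(\<lambda>y. y i) \<in> measurable (PiM {..<j} (\<lambda>_. \<mu>)) \<mu>"
      by (intro measurable_component_singleton) auto
    from measurable_compose[OF this borel_measurable_id_subspace[OF assms]]
    have "(\<lambda>y. y i) \<in> borel_measurable (PiM {..<j} (\<lambda>_. \<mu>))" .
    then have "(\<lambda>y. y i $ l) \<in> borel_measurable (PiM {..<j} (\<lambda>_. \<mu>))"
      by (rule measurable_compose) (intro borel_measurable_continuous_onI continuous_intros)
    with True show ?thesis by simp
  qed simp
  then show ?thesis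
    unfolding monomial_def
    by (intro borel_measurable_sum borel_measurable_times borel_measurable_const)
      (auto simp: case_prod_beta intro!: borel_measurable_prod borel_measurable_power)
qed

text \<open>
  Boundedness of \<open>E\<close> makes all monomials integrable over \<open>E\<close>, so that the uniform comparison of supremum and mean
  applies in each of the \<open>k\<close> variables, with the same set \<open>F\<close>.
\<close>

lemma polynomial_sup_le_product_mean:
  fixes \<mu> :: "(real ^ 'n::finite) measure" and k d :: nat
  assumes "sigma_finite_measure \<mu>" and sets_\<mu>: "sets \<mu> = sets (restrict_space borel \<Omega>)"
    and E: "E \<in> sets \<mu>" "bounded E" and m: "emeasure \<mu> E = ennreal m" "m > 0"
  shows "\<exists>F\<in>sets \<mu>. F \<subseteq> E \<and> ennreal (m / 2) \<le> emeasure \<mu> F \<and>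
    (\<forall>c x. (\<forall>i<k. x i \<in> F) \<longrightarrow>
      ennreal \<bar>\<Sum>\<alpha>\<in>multi_indices k d. c \<alpha> * monomial k \<alpha> x\<bar> \<le>
      ennreal ((comparability_const (card (exponents d :: ('n \<Rightarrow> nat) set)) / m) ^ k) *
      (\<integral>\<^sup>+y\<in>cart_power k E. ennreal \<bar>\<Sum>\<alpha>\<in>multi_indices k d. c \<alpha> * monomial k \<alpha> y\<bar>
        \<partial>(PiM {..<k} (\<lambda>_. \<mu>))))"
proof -
  define q where "q = card (exponents d :: ('n \<Rightarrow> nat) set)"
  define M where "M = restrict_space \<mu> E"
  have space_E: "E \<inter> space \<mu> \<in> sets \<mu>" using E by auto
  have E_space: "E \<subseteq> space \<mu>" using E(1) sets.sets_into_space by auto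
  have space_M: "space M = E" using E_space by (auto simp: M_def space_restrict_space)
  have em: "emeasure M (space M) = ennreal m"
    unfolding space_M unfolding M_def using m by (simp add: emeasure_restrict_space[OF space_E])
  have fin: "finite_measure M" by (rule finite_measureI) (simp add: em)
  have meas_m: "measure M (space M) = m" using em m by (simp add: measure_def)
  have id_\<mu>[measurable]: "(\<lambda>z. z) \<in> borel_measurable \<mu>"
    by (rule borel_measurable_id_subspace[OF sets_\<mu>])
  then have id_M[measurable]: "(\<lambda>z. z) \<in> borel_measurable M"
    unfolding M_def by (rule measurable_restrict_space1)
  have meas_pm: "point_monomial \<beta> \<in> borel_measurable M" for \<beta>
    using measurable_compose[OF id_M borel_measurable_continuous_onI[OF continuous_point_monomial]] by simp
  have int: "integrable M (point_monomial \<beta>)" for \<beta>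
  proof -
    have "compact (point_monomial \<beta> ` closure E)"
      using E(2) by (intro compact_continuous_image continuous_point_monomial) (simp add: compact_closure)
    then obtain b where "\<forall>v\<in>point_monomial \<beta> ` closure E. norm v \<le> b"
      using compact_imp_bounded bounded_iff by blast
    then have "AE z in M. norm (point_monomial \<beta> z) \<le> b"
      using closure_subset[of E] by (intro AE_I2) (auto simp: space_M)
    then show ?thesis
      by (rule finite_measure.integrable_const_bound[OF fin _ meas_pm])
  qed
  have "0 < measure M (space M)" using m meas_m by simp
  from large_subset_sup_le_mean[OF fin finite_exponents[of d] this, of point_monomial, OF int]
  obtain F where F: "F \<in> sets M" "m / 2 \<le> measure M F" and
    F_bound: "\<forall>t. \<forall>z\<in>F. \<bar>\<Sum>\<beta>\<in>exponents d. t \<beta> * point_monomial \<beta> z\<bar> \<le>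
      comparability_const q / m * (\<integral>z. \<bar>\<Sum>\<beta>\<in>exponents d. t \<beta> * point_monomial \<beta> z\<bar> \<partial>M)"
    unfolding meas_m q_def by (elim bexE conjE)
  have bound: "\<bar>\<Sum>\<beta>\<in>exponents d. t \<beta> * point_monomial \<beta> z\<bar> \<le>
      comparability_const q / m * (\<integral>z. \<bar>\<Sum>\<beta>\<in>exponents d. t \<beta> * point_monomial \<beta> z\<bar> \<partial>M)"
    if "z \<in> F" for t z
    using F_bound that by blast
  have F\<mu>: "F \<in> sets \<mu>" "F \<subseteq> E"
    using F(1) E(1) by (auto simp: M_def sets_restrict_space)
  have "ennreal (m / 2) \<le> emeasure M F"
    using F(2) finite_measure.emeasure_eq_measure[OF fin, of F] by (simp add: ennreal_leI)
  then have F_large: "ennreal (m / 2) \<le> emeasure \<mu> F"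
    unfolding M_def using F\<mu> by (simp add: emeasure_restrict_space[OF space_E])
  have main: "ennreal \<bar>\<Sum>\<alpha>\<in>multi_indices k d. c \<alpha> * monomial k \<alpha> x\<bar> \<le>
      ennreal ((comparability_const q / m) ^ k) *
      (\<integral>\<^sup>+y\<in>cart_power k E. ennreal \<bar>\<Sum>\<alpha>\<in>multi_indices k d. c \<alpha> * monomial k \<alpha> y\<bar>
        \<partial>(PiM {..<k} (\<lambda>_. \<mu>)))" if x: "\<forall>i<k. x i \<in> F" for c x
  proof -
    define P where "P x = (\<Sum>\<alpha>\<in>multi_indices k d. c \<alpha> * monomial k \<alpha> x)" for x :: "'n tuple"
    have P_restrict: "P (\<lambda>i. if i < k then y i else x i) = P y" for x y
      by (simp add: P_def monomial_restrict)
    have "ennreal \<bar>P x\<bar> \<le> ennreal (comparability_const q / m) ^ k *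
        (\<integral>\<^sup>+y\<in>cart_power k E. ennreal \<bar>P (\<lambda>i. if i < k then y i else x i)\<bar> \<partial>(PiM {..<k} (\<lambda>_. \<mu>)))"
    proof (rule iterated_mean_bound[where f = "\<lambda>x. ennreal \<bar>P x\<bar>" and F = F])
      fix x :: "'n tuple" and j
      have "(\<lambda>y. P (\<lambda>i. if i < j then y i else x i)) \<in> borel_measurable (PiM {..<j} (\<lambda>_. \<mu>))"
        unfolding P_def by (rule borel_measurable_polynomial_merge[OF sets_\<mu>])
      then show "(\<lambda>y. ennreal \<bar>P (\<lambda>i. if i < j then y i else x i)\<bar>) \<in> borel_measurable (PiM {..<j} (\<lambda>_. \<mu>))"
        by measurable
    next
      fix x :: "'n tuple" and j assume j: "j < k" "x j \<in> F"
      obtain t where t: "\<And>z. P (x(j := z)) = (\<Sum>\<beta>\<in>exponents d. t \<beta> * point_monomial \<beta> z)"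
        using polynomial_slice[OF j(1), where c=c and x=x and d=d] unfolding P_def by blast
      have i: "integrable M (\<lambda>z. \<bar>P (x(j := z))\<bar>)"
        unfolding t by (intro integrable_abs Bochner_Integration.integrable_sum integrable_mult_right int)
      have "\<bar>P x\<bar> \<le> comparability_const q / m * (\<integral>z. \<bar>P (x(j := z))\<bar> \<partial>M)"
        using bound[OF j(2), of t] unfolding t[symmetric] by simp
      then have "ennreal \<bar>P x\<bar> \<le> ennreal (comparability_const q / m) * ennreal (\<integral>z. \<bar>P (x(j := z))\<bar> \<partial>M)"
        using comparability_const_pos[of q] m by (simp add: ennreal_mult'[symmetric] ennreal_leI)
      also have "ennreal (\<integral>z. \<bar>P (x(j := z))\<bar> \<partial>M) = (\<integral>\<^sup>+z. ennreal \<bar>P (x(j := z))\<bar> \<partial>M)"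
        by (rule nn_integral_eq_integral[symmetric, OF i]) simp
      also have "\<dots> = (\<integral>\<^sup>+z\<in>E. ennreal \<bar>P (x(j := z))\<bar> \<partial>\<mu>)"
        unfolding M_def by (rule nn_integral_restrict_space[OF space_E])
      finally show "ennreal \<bar>P x\<bar> \<le> ennreal (comparability_const q / m) * (\<integral>\<^sup>+z\<in>E. ennreal \<bar>P (x(j := z))\<bar> \<partial>\<mu>)" .
    qed (use assms x in auto)
    then show ?thesis
      unfolding P_restrict unfolding P_def using comparability_const_pos[of q] m
      by (simp add: ennreal_power)
  qed
  show ?thesis using F\<mu> F_large main unfolding q_def by blast
qed

section \<open>Powers of measures and exhaustion\<close>

text \<open>
  The power is continuous from below on \<open>[0, \<infinity>]\<close>, also at \<open>\<infinity>\<close>; hence lower bounds for a functional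
  need only be proved in terms of smaller finite measures.
\<close>

lemma ennpowr_le_if_below:
  assumes c: "0 \<le> c" and p: "0 < p"
    and below: "\<And>r. 0 < r \<Longrightarrow> ennreal r < a \<Longrightarrow> ennreal (c * r powr p) \<le> A"
  shows "ennreal c * ennpowr a p \<le> A"
proof (cases a)
  case (real b)
  show ?thesis
  proof (cases "b = 0")
    case True
    then show ?thesis using real by (simp add: ennpowr_def)
  next
    case False
    then have b: "b > 0" using real by simp
    have "(\<lambda>r. ennreal (c * r powr p)) \<midarrow>b\<rightarrow> ennreal (c * b powr p)"
      using b by (intro tendsto_intros) auto
    then have "((\<lambda>r. ennreal (c * r powr p)) \<longlongrightarrow> ennreal (c * b powr p)) (at_left b)"
      by (rule filterlim_mono) (auto simp: at_within_le_at)
    moreover have "\<forall>\<^sub>F r in at_left b. ennreal (c * r powr p) \<le> A"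
      using eventually_at_left_real[OF b]
      by eventually_elim (use below real in \<open>auto simp: ennreal_less_iff\<close>)
    ultimately have "ennreal (c * b powr p) \<le> A"
      by (rule tendsto_upperbound) simp
    then show ?thesis using real c by (simp add: ennpowr_def ennreal_mult')
  qed
next
  case top
  show ?thesis
  proof (cases "c = 0")
    case False
    have "A = top"
    proof (rule ccontr)
      assume "A \<noteq> top"
      then obtain v where v: "A = ennreal v" "v \<ge> 0" by (cases A) auto
      define r where "r = ((v + 1) / c) powr (1 / p)"
      have "r > 0" using v False c by (simp add: r_def)
      then have "ennreal (c * r powr p) \<le> ennreal v" using below[of r] top v by simp
      moreover have "c * r powr p = v + 1" using v False c p by (simp add: r_def powr_powr)
      ultimately show False using v by (simp add: ennreal_le_iff)
    qed
    then show ?thesis by simp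
  qed simp
qed

lemma bounded_subset_of_almost_full_measure:
  fixes \<mu> :: "(real ^ 'n::finite) measure"
  assumes "sigma_finite_measure \<mu>" and sets_\<mu>: "sets \<mu> = sets (restrict_space borel \<Omega>)"
    and E: "E \<in> sets \<mu>" and r: "ennreal r < emeasure \<mu> E"
  shows "\<exists>F\<in>sets \<mu>. F \<subseteq> E \<and> bounded F \<and> emeasure \<mu> F < \<infinity> \<and> ennreal r < emeasure \<mu> F"
proof -
  interpret sigma_finite_measure \<mu> by fact
  obtain A where A: "range A \<subseteq> sets \<mu>" "(\<Union>i. A i) = space \<mu>" "\<And>i. emeasure \<mu> (A i) \<noteq> \<infinity>" "incseq A"
    using sigma_finite_incseq by blast
  define F where "F n = E \<inter> A n \<inter> cball 0 (real n)" for n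
  have E_sub: "E \<subseteq> \<Omega>" and \<Omega>: "space \<mu> = \<Omega>"
    using sets.sets_into_space[OF E] sets_eq_imp_space_eq[OF sets_\<mu>] by (auto simp: space_restrict_space)
  have "cball 0 (real n) \<inter> \<Omega> \<in> sets \<mu>" for n
    unfolding sets_\<mu> by (auto simp: sets_restrict_space)
  then have "E \<inter> A n \<inter> (cball 0 (real n) \<inter> \<Omega>) \<in> sets \<mu>" for n
    using E A(1) by auto
  moreover have "F n = E \<inter> A n \<inter> (cball 0 (real n) \<inter> \<Omega>)" for n using E_sub by (auto simp: F_def)
  ultimately have F: "F n \<in> sets \<mu>" for n by simp
  have "incseq F"
    unfolding incseq_def F_def
  proof (intro allI impI)
    fix m n :: nat assume "m \<le> n"
    then show "E \<inter> A m \<inter> cball 0 (real m) \<subseteq> E \<inter> A n \<inter> cball 0 (real n)"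
      using incseqD[OF A(4) \<open>m \<le> n\<close>] by auto
  qed
  moreover have "(\<Union>n. F n) = E"
  proof
    show "E \<subseteq> (\<Union>n. F n)"
    proof
      fix x assume x: "x \<in> E"
      then obtain i where i: "x \<in> A i" using A(2) E_sub \<Omega> by auto
      obtain j :: nat where j: "norm x \<le> real j" using real_arch_simple by blast
      have "x \<in> A (max i j)" using i incseqD[OF A(4), of i "max i j"] by auto
      moreover have "x \<in> cball 0 (real (max i j))" using j by auto
      ultimately show "x \<in> (\<Union>n. F n)" using x by (auto simp: F_def)
    qed
  qed (auto simp: F_def)
  ultimately have "(SUP n. emeasure \<mu> (F n)) = emeasure \<mu> E"
    using SUP_emeasure_incseq[of F \<mu>] F by auto
  then obtain n where n: "ennreal r < emeasure \<mu> (F n)" using r by (metis less_SUP_iff)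
  have "emeasure \<mu> (F n) \<le> emeasure \<mu> (A n)"
    using A(1) by (intro emeasure_mono) (auto simp: F_def)
  then have "emeasure \<mu> (F n) < \<infinity>" using A(3)[of n] by (simp add: less_top order.strict_trans1)
  moreover have "bounded (F n)" by (rule bounded_subset[of "cball 0 (real n)"]) (auto simp: F_def)
  moreover have "F n \<subseteq> E" by (auto simp: F_def)
  ultimately show ?thesis using F n by blast
qed

lemma avg_functional_mono:
  "E \<subseteq> E' \<Longrightarrow> avg_functional k N \<Phi> \<mu> E \<le> avg_functional k N \<Phi> \<mu> E'"
  unfolding avg_functional_def
  by (intro nn_integral_mono mult_left_mono) (auto simp: indicator_def PiE_iff)

lemma sup_functional_mono:
  "E \<subseteq> E' \<Longrightarrow> sup_functional k N \<Phi> E \<le> sup_functional k N \<Phi> E'"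
  unfolding sup_functional_def by (intro SUP_subset_mono) (auto simp: PiE_iff)

lemma avg_functional_le_sup_functional:
  assumes "sigma_finite_measure \<mu>" "E \<in> sets \<mu>"
  shows "avg_functional k N \<Phi> \<mu> E \<le> sup_functional k N \<Phi> E * emeasure \<mu> E ^ k"
proof -
  interpret sigma_finite_measure \<mu> by fact
  interpret product_sigma_finite "\<lambda>_::nat. \<mu>" by standard
  have "avg_functional k N \<Phi> \<mu> E \<le>
      (\<integral>\<^sup>+x. sup_functional k N \<Phi> E * indicator (cart_power k E) x \<partial>(PiM {..<k} (\<lambda>_. \<mu>)))"
    unfolding avg_functional_def sup_functional_def
    by (intro nn_integral_mono) (auto simp: indicator_def intro!: SUP_upper)
  also have "\<dots> = sup_functional k N \<Phi> E * emeasure (PiM {..<k} (\<lambda>_. \<mu>)) (cart_power k E)"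
    using assms(2) by (intro nn_integral_cmult_indicator sets_PiM_I_finite) auto
  also have "\<dots> = sup_functional k N \<Phi> E * emeasure \<mu> E ^ k"
    using assms(2) by (subst emeasure_PiM) auto
  finally show ?thesis .
qed

section \<open>Comparison of the two functionals\<close>

text \<open>
  On sets of finite positive measure one divides the trivial bound
  \<open>\<A>(E) \<le> \<S>(E) \<mu>(E)\<^sup>k\<close> by \<open>\<mu>(E)\<^sup>k\<close>, which makes the approximation by such
  sets necessary.
\<close>

lemma sup_functional_bound_from_avg:
  fixes \<mu> :: "(real ^ 'n::finite) measure"
  assumes "sigma_finite_measure \<mu>" and sets_\<mu>: "sets \<mu> = sets (restrict_space borel \<Omega>)"
    and "open \<Omega>" and c: "0 \<le> c" and s: "0 < s"
    and avg: "power_bound \<Omega> \<mu> (real k + s) (avg_functional k N \<Phi> \<mu>) c"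
  shows "power_bound \<Omega> \<mu> s (sup_functional k N \<Phi>) c"
  unfolding power_bound_def
proof (intro allI impI)
  fix E assume E: "E \<in> sets borel \<and> E \<subseteq> \<Omega>"
  have sets_iff: "F \<in> sets \<mu> \<longleftrightarrow> F \<in> sets borel \<and> F \<subseteq> \<Omega>" for F
    using \<open>open \<Omega>\<close> unfolding sets_\<mu> by (subst sets_restrict_space_iff) auto
  show "ennreal c * ennpowr (emeasure \<mu> E) s \<le> sup_functional k N \<Phi> E"
  proof (rule ennpowr_le_if_below[OF c s])
    fix r :: real assume r: "0 < r" "ennreal r < emeasure \<mu> E"
    then obtain F where F: "F \<in> sets \<mu>" "F \<subseteq> E" "emeasure \<mu> F < \<infinity>" "ennreal r < emeasure \<mu> F"
      using bounded_subset_of_almost_full_measure[OF assms(1,2), of E r] E by (auto simp: sets_iff)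
    then obtain m where m: "emeasure \<mu> F = ennreal m" "m \<ge> 0"
      by (cases "emeasure \<mu> F") auto
    have rm: "r < m" using F(4) r(1) m by (simp add: ennreal_less_iff)
    have "ennreal c * ennpowr (emeasure \<mu> F) (real k + s) \<le> avg_functional k N \<Phi> \<mu> F"
      using avg F(1) unfolding power_bound_def sets_iff by blast
    also have "\<dots> \<le> sup_functional k N \<Phi> F * ennreal m ^ k"
      using avg_functional_le_sup_functional[OF assms(1) F(1)] m(1) by simp
    also have "ennreal c * ennpowr (emeasure \<mu> F) (real k + s) = ennreal (c * m powr s) * ennreal m ^ k"
      using m(2) c r rm
      by (simp add: m(1) ennpowr_def ennreal_mult[symmetric] ennreal_power powr_add powr_realpow mult_ac)
    finally have "ennreal (m ^ k) * ennreal (c * m powr s) \<le> ennreal (m ^ k) * sup_functional k N \<Phi> F"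
      using m(2) by (simp only: ennreal_power mult.commute)
    then have "ennreal (c * m powr s) \<le> sup_functional k N \<Phi> F"
      using r rm by (subst (asm) ennreal_mult_le_mult_iff) auto
    moreover have "c * r powr s \<le> c * m powr s"
      using r rm s c by (intro mult_left_mono powr_mono2) auto
    ultimately show "ennreal (c * r powr s) \<le> sup_functional k N \<Phi> E"
      using sup_functional_mono[OF F(2), of k N \<Phi>] ennreal_leI order_trans by meson
  qed
qed

text \<open>
  The scalar comparison is applied to each coordinate of \<open>\<Phi>\<close>, with coordinates adapted to the norm \<open>N\<close>: the norm is at most the
  sum of their absolute values, and each of them is at most \<open>3 ^ L\<close> times the norm.
\<close>

lemma sup_functional_large_subset:
  fixes \<mu> :: "(real ^ 'n::finite) measure"
  assumes "sigma_finite_measure \<mu>" and sets_\<mu>: "sets \<mu> = sets (restrict_space borel \<Omega>)"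
    and N: "is_norm_on m N" and \<Phi>: "polynomial_map k m d \<Omega> \<Phi>"
    and E: "E \<in> sets \<mu>" "bounded E" and v: "emeasure \<mu> E = ennreal v" "v > 0"
  defines "L \<equiv> card (multi_indices k d :: (nat \<times> 'n \<Rightarrow> nat) set)"
  defines "K \<equiv> comparability_const (card (exponents d :: ('n \<Rightarrow> nat) set))"
  shows "\<exists>F\<in>sets \<mu>. F \<subseteq> E \<and> ennreal (v / 2) \<le> emeasure \<mu> F \<and>
    sup_functional k N \<Phi> F \<le> ennreal (comparability_const L * (K / v) ^ k) * avg_functional k N \<Phi> \<mu> E"
proof -
  let ?A = "multi_indices k d :: (nat \<times> 'n \<Rightarrow> nat) set"
  have E_sub: "E \<subseteq> \<Omega>"
    using sets.sets_into_space[OF E(1)] sets_eq_imp_space_eq[OF sets_\<mu>] by (auto simp: space_restrict_space)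
  obtain c where c: "\<forall>\<alpha>\<in>?A. c \<alpha> \<in> real_space m"
    and c_eq: "\<forall>x\<in>cart_power k \<Omega>. \<forall>j. \<Phi> x j = (\<Sum>\<alpha>\<in>?A. c \<alpha> j * monomial k \<alpha> x)"
    using \<Phi> unfolding polynomial_map_def by (elim exE conjE)
  have \<Phi>_eq: "\<Phi> x = (\<lambda>j. \<Sum>\<alpha>\<in>?A. monomial k \<alpha> x * c \<alpha> j)" if "x \<in> cart_power k \<Omega>" for x
    using c_eq that by (intro ext) (simp add: mult.commute)
  obtain g where g: "\<forall>t. N (\<lambda>j. \<Sum>\<alpha>\<in>?A. t \<alpha> * c \<alpha> j) \<le> (\<Sum>i\<in>?A. \<bar>\<Sum>\<alpha>\<in>?A. g i \<alpha> * t \<alpha>\<bar>) \<and>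
      (\<forall>i\<in>?A. \<bar>\<Sum>\<alpha>\<in>?A. g i \<alpha> * t \<alpha>\<bar> \<le> 3 ^ L * N (\<lambda>j. \<Sum>\<alpha>\<in>?A. t \<alpha> * c \<alpha> j))"
    using norm_comparable_to_coordinates[where A="?A" and c=c, OF N finite_multi_indices c]
    unfolding L_def by (elim exE)
  have upper: "N (\<lambda>j. \<Sum>\<alpha>\<in>?A. t \<alpha> * c \<alpha> j) \<le> (\<Sum>i\<in>?A. \<bar>\<Sum>\<alpha>\<in>?A. g i \<alpha> * t \<alpha>\<bar>)" for t
    by (rule g[rule_format, THEN conjunct1])
  have lower: "\<bar>\<Sum>\<alpha>\<in>?A. g i \<alpha> * t \<alpha>\<bar> \<le> 3 ^ L * N (\<lambda>j. \<Sum>\<alpha>\<in>?A. t \<alpha> * c \<alpha> j)" if "i \<in> ?A" for t i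
    by (rule g[rule_format, THEN conjunct2, rule_format, OF that])
  define P where "P i x = (\<Sum>\<alpha>\<in>?A. g i \<alpha> * monomial k \<alpha> x)" for i x
  have upper_P: "N (\<Phi> x) \<le> (\<Sum>i\<in>?A. \<bar>P i x\<bar>)" if "x \<in> cart_power k \<Omega>" for x
    unfolding \<Phi>_eq[OF that] P_def by (rule upper)
  have lower_P: "\<bar>P i x\<bar> \<le> 3 ^ L * N (\<Phi> x)" if "x \<in> cart_power k \<Omega>" "i \<in> ?A" for x i
    unfolding \<Phi>_eq[OF that(1)] P_def by (rule lower[OF that(2)])
  have K: "K > 0" unfolding K_def by (rule comparability_const_pos)
  obtain F where F: "F \<in> sets \<mu>" "F \<subseteq> E" "ennreal (v / 2) \<le> emeasure \<mu> F"
    and bound: "\<forall>c x. (\<forall>i<k. x i \<in> F) \<longrightarrow>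
      ennreal \<bar>\<Sum>\<alpha>\<in>?A. c \<alpha> * monomial k \<alpha> x\<bar> \<le> ennreal ((K / v) ^ k) *
      (\<integral>\<^sup>+y\<in>cart_power k E. ennreal \<bar>\<Sum>\<alpha>\<in>?A. c \<alpha> * monomial k \<alpha> y\<bar> \<partial>(PiM {..<k} (\<lambda>_. \<mu>)))"
    using polynomial_sup_le_product_mean[OF assms(1) sets_\<mu> E v, where k=k and d=d] unfolding K_def by (elim bexE conjE)
  have int_P: "(\<integral>\<^sup>+y\<in>cart_power k E. ennreal \<bar>P i y\<bar> \<partial>(PiM {..<k} (\<lambda>_. \<mu>))) \<le>
      ennreal (3 ^ L) * avg_functional k N \<Phi> \<mu> E" if "i \<in> ?A" for i
  proof -
    have "(\<integral>\<^sup>+y\<in>cart_power k E. ennreal (\<bar>P i y\<bar> / 3 ^ L) \<partial>(PiM {..<k} (\<lambda>_. \<mu>))) \<le> avg_functional k N \<Phi> \<mu> E"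
      unfolding avg_functional_def
    proof (rule nn_integral_mono)
      fix y
      show "ennreal (\<bar>P i y\<bar> / 3 ^ L) * indicator (cart_power k E) y \<le>
          ennreal (N (\<Phi> y)) * indicator (cart_power k E) y"
      proof (cases "y \<in> cart_power k E")
        case True
        then have "y \<in> cart_power k \<Omega>" using E_sub by (auto simp: PiE_iff)
        from lower_P[OF this that] have "\<bar>P i y\<bar> / 3 ^ L \<le> N (\<Phi> y)" by (simp add: field_simps)
        then show ?thesis using True by (simp add: ennreal_leI)
      qed simp
    qed
    then have "ennreal (3 ^ L) * (\<integral>\<^sup>+y\<in>cart_power k E. ennreal (\<bar>P i y\<bar> / 3 ^ L) \<partial>(PiM {..<k} (\<lambda>_. \<mu>))) \<le>
        ennreal (3 ^ L) * avg_functional k N \<Phi> \<mu> E" by (rule mult_left_mono) simp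
    moreover have "ennreal (3 ^ L) * (\<integral>\<^sup>+y\<in>cart_power k E. ennreal (\<bar>P i y\<bar> / 3 ^ L) \<partial>(PiM {..<k} (\<lambda>_. \<mu>))) =
      (\<integral>\<^sup>+y. ennreal (3 ^ L) * (ennreal (\<bar>P i y\<bar> / 3 ^ L) * indicator (cart_power k E) y) \<partial>(PiM {..<k} (\<lambda>_. \<mu>)))"
    proof (rule nn_integral_cmult[symmetric])
      have [measurable]: "P i \<in> borel_measurable (PiM {..<k} (\<lambda>_. \<mu>))"
        using borel_measurable_polynomial_merge[OF sets_\<mu>, where j=k and k=k and d=d and c="g i"]
        unfolding monomial_restrict P_def[symmetric] .
      have [measurable]: "cart_power k E \<in> sets (PiM {..<k} (\<lambda>_. \<mu>))"
        using E(1) by (intro sets_PiM_I_finite) auto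
      show "(\<lambda>y. ennreal (\<bar>P i y\<bar> / 3 ^ L) * indicator (cart_power k E) y)
          \<in> borel_measurable (PiM {..<k} (\<lambda>_. \<mu>))" by measurable
    qed
    moreover have "ennreal (3 ^ L) * (ennreal (\<bar>P i y\<bar> / 3 ^ L) * indicator (cart_power k E) y) =
        ennreal \<bar>P i y\<bar> * indicator (cart_power k E) y" for y
      by (subst mult.assoc[symmetric], subst ennreal_mult'[symmetric]) auto
    ultimately show ?thesis by simp
  qed
  have "ennreal (N (\<Phi> x)) \<le> ennreal (comparability_const L * (K / v) ^ k) * avg_functional k N \<Phi> \<mu> E"
    if x: "x \<in> cart_power k F" for x
  proof -
    have "x \<in> cart_power k \<Omega>" using x F(2) E_sub by (auto simp: PiE_iff)
    then have "ennreal (N (\<Phi> x)) \<le> (\<Sum>i\<in>?A. ennreal \<bar>P i x\<bar>)"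
      using upper_P by (simp add: ennreal_leI)
    also have "\<dots> \<le> (\<Sum>i\<in>?A. ennreal ((K / v) ^ k) * (ennreal (3 ^ L) * avg_functional k N \<Phi> \<mu> E))"
    proof (rule sum_mono)
      fix i assume i: "i \<in> ?A"
      have "ennreal \<bar>P i x\<bar> \<le> ennreal ((K / v) ^ k) *
          (\<integral>\<^sup>+y\<in>cart_power k E. ennreal \<bar>P i y\<bar> \<partial>(PiM {..<k} (\<lambda>_. \<mu>)))"
        unfolding P_def using x by (intro bound[rule_format]) auto
      also have "\<dots> \<le> ennreal ((K / v) ^ k) * (ennreal (3 ^ L) * avg_functional k N \<Phi> \<mu> E)"
        by (intro mult_left_mono int_P i) simp
      finally show "ennreal \<bar>P i x\<bar> \<le> ennreal ((K / v) ^ k) * (ennreal (3 ^ L) * avg_functional k N \<Phi> \<mu> E)" .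
    qed
    also have "\<dots> = ennreal (real L * (K / v) ^ k * 3 ^ L) * avg_functional k N \<Phi> \<mu> E"
      using K v(2) by (simp add: L_def[symmetric] ennreal_of_nat_eq_real_of_nat ennreal_mult' mult.assoc)
    also have "\<dots> \<le> ennreal (comparability_const L * (K / v) ^ k) * avg_functional k N \<Phi> \<mu> E"
    proof (intro mult_right_mono ennreal_leI)
      have "real L * 3 ^ L * (K / v) ^ k \<le> comparability_const L * (K / v) ^ k"
        using K v(2) by (intro mult_right_mono) (auto simp: comparability_const_def)
      then show "real L * (K / v) ^ k * 3 ^ L \<le> comparability_const L * (K / v) ^ k" by (simp add: mult_ac)
    qed simp
    finally show ?thesis .
  qed
  then have "sup_functional k N \<Phi> F \<le> ennreal (comparability_const L * (K / v) ^ k) * avg_functional k N \<Phi> \<mu> E"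
    unfolding sup_functional_def by (intro SUP_least)
  with F show ?thesis by blast
qed

text \<open>The type argument supplies the dimension \<open>n\<close>.\<close>

definition comparison_const :: "'n::finite itself \<Rightarrow> nat \<Rightarrow> nat \<Rightarrow> real \<Rightarrow> real" where
  "comparison_const _ k d s =
     2 powr s * comparability_const (card (multi_indices k d :: (nat \<times> 'n::finite \<Rightarrow> nat) set)) *
     comparability_const (card (exponents d :: ('n \<Rightarrow> nat) set)) ^ k"

lemma comparison_const_pos: "comparison_const TYPE('n::finite) k d s > 0"
  by (simp add: comparison_const_def comparability_const_pos)

text \<open>
  Let \<open>G\<close> be a bounded part of \<open>E\<close> of finite measure. The hypothesis is applied not to \<open>G\<close> but to the large
  subset \<open>F\<close> of \<open>G\<close> on which the supremum is controlled by the average over \<open>G\<close>; passing to half of the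
  measure costs the factor \<open>2 powr s\<close>.
\<close>

lemma avg_functional_bound_from_sup:
  fixes \<mu> :: "(real ^ 'n::finite) measure"
  assumes "sigma_finite_measure \<mu>" and sets_\<mu>: "sets \<mu> = sets (restrict_space borel \<Omega>)"
    and "open \<Omega>" and c: "0 \<le> c" and s: "0 < s"
    and N: "is_norm_on m N" and \<Phi>: "polynomial_map k m d \<Omega> \<Phi>"
    and sup: "power_bound \<Omega> \<mu> s (sup_functional k N \<Phi>) c"
  shows "power_bound \<Omega> \<mu> (real k + s) (avg_functional k N \<Phi> \<mu>) (1 / comparison_const TYPE('n) k d s * c)"
  unfolding power_bound_def
proof (intro allI impI)
  fix E assume E: "E \<in> sets borel \<and> E \<subseteq> \<Omega>"
  define L where "L = comparability_const (card (multi_indices k d :: (nat \<times> 'n \<Rightarrow> nat) set))"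
  define K where "K = comparability_const (card (exponents d :: ('n \<Rightarrow> nat) set))"
  define C where "C = comparison_const TYPE('n) k d s"
  have pos: "C > 0" "K > 0" "L > 0"
    unfolding C_def K_def L_def by (rule comparison_const_pos comparability_const_pos)+
  have C: "C = 2 powr s * L * K ^ k" unfolding C_def L_def K_def by (rule comparison_const_def)
  have sets_iff: "F \<in> sets \<mu> \<longleftrightarrow> F \<in> sets borel \<and> F \<subseteq> \<Omega>" for F
    using \<open>open \<Omega>\<close> unfolding sets_\<mu> by (subst sets_restrict_space_iff) auto
  show "ennreal (1 / comparison_const TYPE('n) k d s * c) * ennpowr (emeasure \<mu> E) (real k + s)
      \<le> avg_functional k N \<Phi> \<mu> E"
    unfolding C_def[symmetric]
  proof (rule ennpowr_le_if_below)
    fix r :: real assume r: "0 < r" "ennreal r < emeasure \<mu> E"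
    then obtain G where G: "G \<in> sets \<mu>" "G \<subseteq> E" "bounded G" "emeasure \<mu> G < \<infinity>" "ennreal r < emeasure \<mu> G"
      using bounded_subset_of_almost_full_measure[OF assms(1,2), of E r] E by (auto simp: sets_iff)
    then obtain v where v: "emeasure \<mu> G = ennreal v" "v \<ge> 0"
      by (cases "emeasure \<mu> G") auto
    have rv: "r < v" using G(5) r(1) v by (simp add: ennreal_less_iff)
    then have v_pos: "v > 0" using r by simp
    obtain F where F: "F \<in> sets \<mu>" "F \<subseteq> G" "ennreal (v / 2) \<le> emeasure \<mu> F" and
      sup_le: "sup_functional k N \<Phi> F \<le> ennreal (L * (K / v) ^ k) * avg_functional k N \<Phi> \<mu> G"
      using sup_functional_large_subset[OF assms(1,2) N \<Phi> G(1,3) v(1) v_pos]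
      unfolding L_def K_def by blast
    have "emeasure \<mu> F \<le> ennreal v" using emeasure_mono[OF F(2) G(1)] v(1) by simp
    then obtain u where u: "emeasure \<mu> F = ennreal u" "u \<ge> 0"
      by (cases "emeasure \<mu> F") (auto simp: top_unique)
    have uv: "v / 2 \<le> u" using F(3) u v_pos by (simp add: ennreal_le_iff)
    have "ennreal (c * (v / 2) powr s) \<le> ennreal (c * u powr s)"
      using c s uv v_pos by (intro ennreal_leI mult_left_mono powr_mono2) auto
    also have "\<dots> = ennreal c * ennpowr (emeasure \<mu> F) s"
      using u c by (simp add: ennpowr_def ennreal_mult')
    also have "\<dots> \<le> sup_functional k N \<Phi> F"
      using sup F(1) unfolding power_bound_def sets_iff by blast
    also note sup_le
    finally have "ennreal (c * (v / 2) powr s) \<le> ennreal (L * (K / v) ^ k) * avg_functional k N \<Phi> \<mu> G" .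
    moreover have "ennreal (c * (v / 2) powr s) = ennreal (L * (K / v) ^ k) * ennreal (1 / C * c * v powr (real k + s))"
    proof -
      have "c * (v / 2) powr s = L * (K / v) ^ k * (1 / C * c * v powr (real k + s))"
        using pos v_pos unfolding C
        by (simp add: powr_divide powr_add powr_realpow power_divide field_simps)
      then show ?thesis using pos v_pos by (simp only: ennreal_mult'[symmetric] zero_le_mult_iff zero_le_power zero_le_divide_iff less_imp_le simp_thms)
    qed
    ultimately have "ennreal (1 / C * c * v powr (real k + s)) \<le> avg_functional k N \<Phi> \<mu> G"
      using pos v_pos by (simp add: ennreal_mult_le_mult_iff)
    moreover have "1 / C * c * r powr (real k + s) \<le> 1 / C * c * v powr (real k + s)"
      using r rv s c pos by (intro mult_left_mono powr_mono2) auto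
    ultimately show "ennreal (1 / C * c * r powr (real k + s)) \<le> avg_functional k N \<Phi> \<mu> E"
      using avg_functional_mono[OF G(2), of k N \<Phi> \<mu>] ennreal_leI order_trans by meson
  qed (use pos c s in auto)
qed

theorem theorem2:
  fixes k d :: nat and s :: real
  assumes "k \<ge> 1" and "s > 0"
  shows "\<exists>C::real. C > 0 \<and>
    (\<forall>(m::nat) (q::nat) (N :: (nat \<Rightarrow> real) \<Rightarrow> real) (\<Omega> :: (real ^ 'n) set)
      (\<Phi> :: 'n tuple \<Rightarrow> nat \<Rightarrow> real) (\<mu> :: (real ^ 'n) measure).
      m \<ge> 1 \<and> q \<ge> 1 \<and> is_norm_on m N \<and>
      open \<Omega> \<and> connected \<Omega> \<and> \<Omega> \<noteq> {} \<and>
      polynomial_map k m d \<Omega> \<Phi> \<and> vanishes_to_order k m q \<Omega> \<Phi> \<and>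
      sets \<mu> = sets (restrict_space borel \<Omega>) \<and> sigma_finite_measure \<mu> \<longrightarrow>
      ((\<exists>c>0. power_bound \<Omega> \<mu> (real k + s) (avg_functional k N \<Phi> \<mu>) c) \<longleftrightarrow>
       (\<exists>c'>0. power_bound \<Omega> \<mu> s (sup_functional k N \<Phi>) c')) \<and>
      best_constant \<Omega> \<mu> s (sup_functional k N \<Phi>)
        \<ge> best_constant \<Omega> \<mu> (real k + s) (avg_functional k N \<Phi> \<mu>) \<and>
      best_constant \<Omega> \<mu> (real k + s) (avg_functional k N \<Phi> \<mu>)
        \<ge> ennreal (1 / C) * best_constant \<Omega> \<mu> s (sup_functional k N \<Phi>))"
proof (intro exI[of _ "comparison_const TYPE('n) k d s"] conjI[OF comparison_const_pos] allI impI)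
  fix m q :: nat and N :: "(nat \<Rightarrow> real) \<Rightarrow> real" and \<Omega> :: "(real ^ 'n) set"
    and \<Phi> :: "'n tuple \<Rightarrow> nat \<Rightarrow> real" and \<mu> :: "(real ^ 'n) measure"
  assume *: "m \<ge> 1 \<and> q \<ge> 1 \<and> is_norm_on m N \<and> open \<Omega> \<and> connected \<Omega> \<and> \<Omega> \<noteq> {} \<and>
      polynomial_map k m d \<Omega> \<Phi> \<and> vanishes_to_order k m q \<Omega> \<Phi> \<and>
      sets \<mu> = sets (restrict_space borel \<Omega>) \<and> sigma_finite_measure \<mu>"
  let ?C = "comparison_const TYPE('n) k d s"
  let ?avg = "power_bound \<Omega> \<mu> (real k + s) (avg_functional k N \<Phi> \<mu>)"
  let ?sup = "power_bound \<Omega> \<mu> s (sup_functional k N \<Phi>)"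
  have C: "?C > 0" by (rule comparison_const_pos)
  have avg_to_sup: "?sup c" if "0 \<le> c" "?avg c" for c
    using sup_functional_bound_from_avg[of \<mu> \<Omega> c s k N \<Phi>] that * \<open>s > 0\<close> by blast
  have sup_to_avg: "?avg (1 / ?C * c)" if "0 \<le> c" "?sup c" for c
    using avg_functional_bound_from_sup[of \<mu> \<Omega> c s m N k d \<Phi>] that * \<open>s > 0\<close> by blast
  have "(\<exists>c>0. ?avg c) \<longleftrightarrow> (\<exists>c'>0. ?sup c')"
  proof
    assume "\<exists>c'>0. ?sup c'"
    then obtain c' where c': "c' > 0" "?sup c'" by blast
    then show "\<exists>c>0. ?avg c"
      using sup_to_avg[of c'] C by (intro exI[of _ "1 / ?C * c'"]) simp
  qed (use avg_to_sup less_imp_le in blast)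
  moreover have "best_constant \<Omega> \<mu> (real k + s) (avg_functional k N \<Phi> \<mu>) \<le>
      best_constant \<Omega> \<mu> s (sup_functional k N \<Phi>)"
    unfolding best_constant_def using avg_to_sup by (intro SUP_subset_mono) auto
  moreover have "ennreal (1 / ?C) * best_constant \<Omega> \<mu> s (sup_functional k N \<Phi>) \<le>
      best_constant \<Omega> \<mu> (real k + s) (avg_functional k N \<Phi> \<mu>)"
  proof -
    have "ennreal (1 / ?C) * best_constant \<Omega> \<mu> s (sup_functional k N \<Phi>) =
        (SUP c\<in>{c. 0 \<le> c \<and> ?sup c}. ennreal (1 / ?C) * ennreal c)"
      unfolding best_constant_def by (rule SUP_mult_left_ennreal)
    also have "\<dots> \<le> best_constant \<Omega> \<mu> (real k + s) (avg_functional k N \<Phi> \<mu>)"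
    proof (rule SUP_least)
      fix c assume "c \<in> {c. 0 \<le> c \<and> ?sup c}"
      then have "1 / ?C * c \<in> {c. 0 \<le> c \<and> ?avg c}" using sup_to_avg[of c] C by auto
      then have "ennreal (1 / ?C * c) \<le> best_constant \<Omega> \<mu> (real k + s) (avg_functional k N \<Phi> \<mu>)"
        unfolding best_constant_def by (rule SUP_upper)
      then show "ennreal (1 / ?C) * ennreal c \<le> best_constant \<Omega> \<mu> (real k + s) (avg_functional k N \<Phi> \<mu>)"
        using C by (simp only: ennreal_mult'[symmetric] zero_le_divide_1_iff less_imp_le)
    qed
    finally show ?thesis .
  qed
  ultimately show "((\<exists>c>0. ?avg c) \<longleftrightarrow> (\<exists>c'>0. ?sup c')) \<and>
      best_constant \<Omega> \<mu> s (sup_functional k N \<Phi>)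
        \<ge> best_constant \<Omega> \<mu> (real k + s) (avg_functional k N \<Phi> \<mu>) \<and>
      best_constant \<Omega> \<mu> (real k + s) (avg_functional k N \<Phi> \<mu>)
        \<ge> ennreal (1 / ?C) * best_constant \<Omega> \<mu> s (sup_functional k N \<Phi>)" by blast
qed

end
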